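(* For every fixed integer $r\ge 3$ there are constants $C,N_0>0$ such that for every prime $N\ge N_0$ there exists a set $I\subseteq \mathbb{Z}/N\mathbb{Z}$ such that (i) $I$ contains no $r$-AP in $\mathbb{Z}/N\mathbb{Z}$, and (ii) $|I\cap K|\ge 1$ for every $k$-AP $K$ in $\mathbb{Z}/N\mathbb{Z}$, where $k=k_N:=\bigl\lceil C (N/\log N)^{1/(r-1)}\log N\bigr\rceil$.
   Context: For a prime $N$ and an integer $\ell\ge 2$, a set $\{a_1,\dots,a_\ell\}\subseteq \mathbb{Z}/N\mathbb{Z}$ is an $\ell$-term arithmetic progression ($\ell$-AP) in $\mathbb{Z}/N\mathbb{Z}$ if $|\{a_1,\dots,a_\ell\}|=\ell$ and there is $d\not\equiv 0 \pmod N$ with $a_i\equiv a_1+(i-1)d \pmod N$ for all $i$. *)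

theory Defs
  imports Complex_Main "HOL-Number_Theory.Number_Theory"
begin

text \<open>The elements of \<open>\<int>/N\<int>\<close> are represented by \<open>carrier (residue_ring (int N))\<close>, that is, by
  the integers \<open>0, \<dots>, N - 1\<close>; equality in \<open>\<int>/N\<int>\<close> is congruence modulo \<open>N\<close>.
  An arithmetic progression is an unordered set, and its terms \<open>a 1, \<dots>, a l\<close> are required
  to be pairwise distinct.  The notion is only meaningful for \<open>l \<ge> 2\<close>, so no set is an
  \<open>l\<close>-term progression for \<open>l < 2\<close>.\<close>

definition is_AP :: "nat \<Rightarrow> nat \<Rightarrow> int set \<Rightarrow> bool" where
  "is_AP N l A \<longleftrightarrow>
     l \<ge> 2 \<and>
     A \<subseteq> carrier (residue_ring (int N)) \<and>
     card A = l \<and>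
     (\<exists>(a :: nat \<Rightarrow> int) (d :: int).
        A = a ` {1..l} \<and>
        \<not> [d = 0] (mod int N) \<and>
        (\<forall>i\<in>{1..l}. [a i = a 1 + (int i - 1) * d] (mod int N)))"

definition AP_length :: "nat \<Rightarrow> real \<Rightarrow> nat \<Rightarrow> nat" where
  "AP_length r C N =
     nat \<lceil>C * (real N / ln (real N)) powr (1 / (real r - 1)) * ln (real N)\<rceil>"

end

theory Submission
  imports Defs "HOL-Real_Asymp.Real_Asymp"
begin

text \<open>A random set of the right density with one point deleted from each of its \<open>r\<close>-term progressions
  misses the target by a power of \<open>log N\<close>.  The loss is recovered by replacing points by
  translates of a structured set \<open>F\<close> of polylogarithmic size.  Take a sphere \<open>S\<close> in the cube
  \<open>{0, \<dots>, m - 1}\<^sup>D\<close> with \<open>m\<close> about \<open>log N\<close> and \<open>D = 5 (r - 1)\<close>, and let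
  \<open>F = {s \<bullet> g | s \<in> S}\<close> for a generic \<open>g \<in> (\<int>/N\<int>)\<^sup>D\<close>.  By strict convexity \<open>F\<close> has no 3-term
  progression, yet it has density at least \<open>1 / (D m\<^sup>2)\<close> in the image of the cube, which has small
  doubling.  Let \<open>I = I0 + F\<close>, where \<open>I0\<close> is a random set from which a maximal
  disjoint family of conflicts is removed, a conflict being a set of centers whose translates
  may jointly contain an \<open>r\<close>-term progression.  Because of the small doubling there are few conflicts:
  two centers leave only \<open>O(m\<^sup>D)\<close> choices for each of the others.  Finally, for generic \<open>g\<close>
  no four points of \<open>S\<close> that are not coplanar land on the same \<open>k\<close>-term progression, so a translate
  of \<open>F\<close> meets it in at most \<open>m\<^sup>2\<close> points; hence the progression meets many translates, enough for
  a union bound over all \<open>N\<^sup>2\<close> progressions.\<close>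

subsection \<open>Random subsets and sparse hypergraphs\<close>

lemma sum_UNION_le:
  fixes w :: "'b \<Rightarrow> real"
  assumes "finite I" "\<And>i. i \<in> I \<Longrightarrow> finite (A i)" "\<And>x. 0 \<le> w x"
  shows "(\<Sum>x\<in>(\<Union>i\<in>I. A i). w x) \<le> (\<Sum>i\<in>I. \<Sum>x\<in>A i. w x)"
  using assms(1,2)
proof (induction I rule: finite_induct)
  case (insert i I)
  have "(\<Sum>x\<in>A i \<union> (\<Union>i\<in>I. A i). w x) \<le> (\<Sum>x\<in>A i. w x) + (\<Sum>x\<in>(\<Union>i\<in>I. A i). w x)"
    using insert by (subst sum.union_inter[symmetric]) (auto intro!: sum_nonneg assms(3))
  with insert show ?case by auto
qed simp

text \<open>The probability that a random subset of \<open>V\<close>, containing each element independently with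
  probability \<open>q\<close>, equals \<open>R\<close>.\<close>

definition rweight :: "real \<Rightarrow> 'a set \<Rightarrow> 'a set \<Rightarrow> real" where
  "rweight q V R = q ^ card R * (1 - q) ^ card (V - R)"

lemma rweight_nonneg: "0 \<le> q \<Longrightarrow> q \<le> 1 \<Longrightarrow> 0 \<le> rweight q V R"
  by (simp add: rweight_def)

text \<open>By independence the expectation of a multiplicative weight factorizes over
  \<open>V\<close>. The choice \<open>f = 1\<close> gives total mass 1; the value 1/2 on a subset
  gives the lower tail.\<close>

lemma sum_rweight_prod:
  assumes "finite V"
  shows "(\<Sum>R\<in>Pow V. rweight q V R * (\<Prod>x\<in>R. f x)) = (\<Prod>x\<in>V. q * f x + (1 - q))"
proof -
  have "(\<Prod>x\<in>V. q * f x + (1 - q)) = (\<Sum>R\<in>Pow V. (\<Prod>x\<in>R. q * f x) * (\<Prod>x\<in>V-R. 1 - q))"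
    by (rule prod_add) (rule assms)
  then show ?thesis
    by (simp add: rweight_def prod.distrib mult_ac)
qed

lemma sum_rweight: "finite V \<Longrightarrow> (\<Sum>R\<in>Pow V. rweight q V R) = 1"
  using sum_rweight_prod[of V q "\<lambda>_. 1"] by simp

lemma sum_rweight_superset:
  assumes "finite V" "S \<subseteq> V"
  shows "(\<Sum>R | R \<subseteq> V \<and> S \<subseteq> R. rweight q V R) = q ^ card S"
proof -
  have fS: "finite S" using assms finite_subset by blast
  have "q ^ card S = (\<Prod>x\<in>S. q) * (\<Prod>x\<in>V-S. q + (1 - q))"
    by simp
  also have "(\<Prod>x\<in>V-S. q + (1 - q)) = (\<Sum>R\<in>Pow (V-S). (\<Prod>x\<in>R. q) * (\<Prod>x\<in>V-S-R. 1 - q))"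
    by (rule prod_add) (use assms in auto)
  also have "(\<Prod>x\<in>S. q) * \<dots> = (\<Sum>R\<in>Pow (V-S). rweight q V (S \<union> R))"
    unfolding sum_distrib_left
  proof (rule sum.cong)
    fix R assume R: "R \<in> Pow (V - S)"
    then have "finite R" using assms finite_subset by blast
    then have "card (S \<union> R) = card S + card R" using R fS by (subst card_Un_disjoint) auto
    moreover have "V - (S \<union> R) = V - S - R" by auto
    ultimately show "(\<Prod>x\<in>S. q) * ((\<Prod>x\<in>R. q) * (\<Prod>x\<in>V-S-R. 1 - q)) = rweight q V (S \<union> R)"
      by (simp add: rweight_def power_add)
  qed simp
  also have "\<dots> = (\<Sum>R | R \<subseteq> V \<and> S \<subseteq> R. rweight q V R)"
    by (rule sum.reindex_bij_witness[of _ "\<lambda>R. R - S" "\<lambda>R. S \<union> R"]) (use assms in auto)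
  finally show ?thesis by simp
qed

text \<open>Markov's inequality for the weight \<open>2 ^ t * (1/2) ^ card (R \<inter> U)\<close>:
  it is at least 1 on the bad event, and by independence its expectation is
  \<open>2 ^ t * (1 - q / 2) ^ card U\<close>.\<close>

lemma rweight_lower_tail:
  assumes "finite V" "U \<subseteq> V" "0 \<le> q" "q \<le> 1"
  shows "(\<Sum>R | R \<subseteq> V \<and> card (R \<inter> U) \<le> t. rweight q V R) \<le> 2 ^ t * exp (- q * card U / 2)"
proof -
  let ?f = "\<lambda>x. if x \<in> U then 1/2 else (1::real)"
  have fin: "finite (Pow V)" using assms by simp
  have "(\<Sum>R | R \<subseteq> V \<and> card (R \<inter> U) \<le> t. rweight q V R)
      \<le> (\<Sum>R | R \<subseteq> V \<and> card (R \<inter> U) \<le> t. 2 ^ t * (rweight q V R * (\<Prod>x\<in>R. ?f x)))"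
  proof (rule sum_mono)
    fix R assume R: "R \<in> {R. R \<subseteq> V \<and> card (R \<inter> U) \<le> t}"
    have "finite R" using R assms finite_subset by blast
    then have "(\<Prod>x\<in>R. ?f x) = (\<Prod>x\<in>R \<inter> U. 1/2)"
      by (intro prod.mono_neutral_cong_right) auto
    then have "(\<Prod>x\<in>R. ?f x) = (1/2) ^ card (R \<inter> U)" by simp
    moreover have "(1::real) \<le> 2 ^ t * (1/2) ^ card (R \<inter> U)"
    proof -
      have "(2::real) ^ card (R \<inter> U) \<le> 2 ^ t" using R by (intro power_increasing) auto
      then show ?thesis by (simp add: power_divide field_simps)
    qed
    ultimately have "1 \<le> 2 ^ t * (\<Prod>x\<in>R. ?f x)" by simp
    from mult_left_mono[OF this rweight_nonneg[OF assms(3,4)]]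
    show "rweight q V R \<le> 2 ^ t * (rweight q V R * (\<Prod>x\<in>R. ?f x))"
      by (simp add: mult_ac)
  qed
  also have "\<dots> \<le> (\<Sum>R\<in>Pow V. 2 ^ t * (rweight q V R * (\<Prod>x\<in>R. ?f x)))"
    by (rule sum_mono2) (use fin assms in \<open>auto intro!: mult_nonneg_nonneg rweight_nonneg prod_nonneg\<close>)
  also have "\<dots> = 2 ^ t * (\<Prod>x\<in>V. q * ?f x + (1 - q))"
    by (simp add: sum_rweight_prod[OF assms(1)] flip: sum_distrib_left)
  also have "(\<Prod>x\<in>V. q * ?f x + (1 - q)) = (\<Prod>x\<in>U. 1 - q / 2)"
    using assms by (intro prod.mono_neutral_cong_right) auto
  also have "\<dots> = (1 - q / 2) ^ card U" by simp
  also have "\<dots> \<le> exp (- q / 2) ^ card U"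
    by (rule power_mono) (use assms exp_ge_add_one_self[of "- q / 2"] in auto)
  also have "\<dots> = exp (- q * card U / 2)"
    by (simp add: mult.commute flip: exp_of_nat_mult)
  finally show ?thesis by simp
qed

text \<open>Disjoint edges are present independently, so a union bound over families leaves at most
  the \<open>s\<close>-th elementary symmetric sum of the numbers \<open>q ^ card e\<close>. That
  sum is at most the product of all \<open>1 + t * q ^ card e\<close>, divided by
  \<open>t ^ s\<close>, with \<open>t\<close> free to be optimized.\<close>

lemma rweight_disjoint_family:
  assumes V: "finite V" and E: "\<And>e. e \<in> E \<Longrightarrow> e \<subseteq> V" and q: "0 \<le> q" "q \<le> 1"
    and \<mu>: "(\<Sum>e\<in>E. q ^ card e) \<le> \<mu>" and t: "t > 0"
  shows "(\<Sum>R | R \<subseteq> V \<and> (\<exists>F\<subseteq>E. card F = s \<and> pairwise disjnt F \<and> \<Union>F \<subseteq> R). rweight q V R)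
           \<le> exp (t * \<mu>) / t ^ s"
proof -
  let ?\<F> = "{F. F \<subseteq> E \<and> card F = s \<and> pairwise disjnt F}"
  have fE: "finite E" by (rule finite_subset[of E "Pow V"]) (use E V in auto)
  have fF: "finite ?\<F>" by (rule finite_subset[of _ "Pow E"]) (use fE in auto)
  have fR: "finite {R. R \<subseteq> V \<and> P R}" for P by (rule finite_subset[of _ "Pow V"]) (use V in auto)
  have "(\<Sum>R | R \<subseteq> V \<and> (\<exists>F\<subseteq>E. card F = s \<and> pairwise disjnt F \<and> \<Union>F \<subseteq> R). rweight q V R)
      \<le> (\<Sum>R\<in>(\<Union>F\<in>?\<F>. {R. R \<subseteq> V \<and> \<Union>F \<subseteq> R}). rweight q V R)"
    by (rule sum_mono2) (use fF fR rweight_nonneg q in auto)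
  also have "\<dots> \<le> (\<Sum>F\<in>?\<F>. \<Sum>R | R \<subseteq> V \<and> \<Union>F \<subseteq> R. rweight q V R)"
    by (rule sum_UNION_le) (use fF fR rweight_nonneg q in auto)
  also have "\<dots> = (\<Sum>F\<in>?\<F>. \<Prod>e\<in>F. q ^ card e)"
  proof (rule sum.cong)
    fix F assume F: "F \<in> ?\<F>"
    have "card (\<Union>F) = (\<Sum>e\<in>F. card e)"
      using F E V by (intro card_Union_disjoint) (auto intro: finite_subset)
    moreover have "\<Union>F \<subseteq> V" using F E by blast
    ultimately show "(\<Sum>R | R \<subseteq> V \<and> \<Union>F \<subseteq> R. rweight q V R) = (\<Prod>e\<in>F. q ^ card e)"
      by (simp add: sum_rweight_superset[OF V] power_sum)
  qed simp
  also have "\<dots> = (\<Sum>F\<in>?\<F>. (\<Prod>e\<in>F. t * q ^ card e) / t ^ s)"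
    by (rule sum.cong) (use t in \<open>auto simp: prod.distrib\<close>)
  also have "\<dots> \<le> (\<Sum>F\<in>Pow E. (\<Prod>e\<in>F. t * q ^ card e) / t ^ s)"
    by (rule sum_mono2) (use fE t q in \<open>auto intro!: divide_nonneg_nonneg prod_nonneg\<close>)
  also have "\<dots> = (\<Prod>e\<in>E. t * q ^ card e + 1) / t ^ s"
    by (subst prod_add[OF fE]) (simp add: sum_divide_distrib)
  also have "\<dots> \<le> (\<Prod>e\<in>E. exp (t * q ^ card e)) / t ^ s"
  proof (intro divide_right_mono prod_mono conjI)
    fix e
    show "0 \<le> t * q ^ card e + 1" using t q by (simp add: add_nonneg_nonneg)
    show "t * q ^ card e + 1 \<le> exp (t * q ^ card e)"
      using exp_ge_add_one_self[of "t * q ^ card e"] by (simp add: add.commute)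
  qed (use t in auto)
  also have "\<dots> = exp (t * (\<Sum>e\<in>E. q ^ card e)) / t ^ s"
    using fE by (simp add: exp_sum sum_distrib_left)
  also have "\<dots> \<le> exp (t * \<mu>) / t ^ s"
    using \<mu> t by (intro divide_right_mono) auto
  finally show ?thesis .
qed

text \<open>Deletion method. For each \<open>U\<close> there are two bad events: the random set
  \<open>R\<close> has at most \<open>r * s\<close> points in \<open>U\<close>, or \<open>R\<close>
  contains \<open>s\<close> disjoint edges meeting \<open>U\<close>. If neither occurs, fewer than
  \<open>s\<close> deleted edges meet \<open>U\<close>, each costs at most \<open>r\<close> points,
  and some point of \<open>R \<inter> U\<close> survives.\<close>

lemma hypergraph_transversal_independent_set:
  fixes V :: "'a set" and E :: "'a set set" and \<U> :: "'a set set" and q :: real and r s :: nat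
  assumes V: "finite V"
    and E: "\<And>e. e \<in> E \<Longrightarrow> e \<subseteq> V \<and> e \<noteq> {} \<and> card e \<le> r"
    and q: "0 < q" "q \<le> 1"
    and r: "r > 0"
    and deg: "\<And>v. v \<in> V \<Longrightarrow> (\<Sum>e | e \<in> E \<and> v \<in> e. q ^ card e) \<le> q / (200 * r)"
    and \<U>: "finite \<U>" "\<And>U. U \<in> \<U> \<Longrightarrow> U \<subseteq> V \<and> 10 * r * s \<le> q * card U \<and> q * card U \<le> 20 * r * s"
    and small: "2 * card \<U> * exp (- real s) < 1"
  shows "\<exists>I\<subseteq>V. (\<forall>e\<in>E. \<not> e \<subseteq> I) \<and> (\<forall>U\<in>\<U>. I \<inter> U \<noteq> {})"
proof -
  let ?EU = "\<lambda>U. {e\<in>E. e \<inter> U \<noteq> {}}"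
  let ?B1 = "\<lambda>U. {R. R \<subseteq> V \<and> card (R \<inter> U) \<le> r * s}"
  let ?B2 = "\<lambda>U. {R. R \<subseteq> V \<and> (\<exists>F\<subseteq>?EU U. card F = s \<and> pairwise disjnt F \<and> \<Union>F \<subseteq> R)}"
  have fE: "finite E" by (rule finite_subset[of E "Pow V"]) (use E V in auto)
  have fP: "finite {R. R \<subseteq> V \<and> P R}" for P by (rule finite_subset[of _ "Pow V"]) (use V in auto)
  have w0: "0 \<le> rweight q V R" for R using q by (intro rweight_nonneg) auto
  have b1: "(\<Sum>R\<in>?B1 U. rweight q V R) \<le> exp (- real s)" if U: "U \<in> \<U>" for U
  proof -
    have "(\<Sum>R\<in>?B1 U. rweight q V R) \<le> 2 ^ (r * s) * exp (- q * card U / 2)"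
      using \<U>(2)[OF U] q V by (intro rweight_lower_tail) auto
    also have "\<dots> \<le> exp 1 ^ (r * s) * exp (- real (5 * r * s))"
    proof (intro mult_mono power_mono)
      show "(2::real) \<le> exp 1" using exp_ge_add_one_self[of 1] by simp
      show "exp (- q * card U / 2) \<le> exp (- real (5 * r * s))" using \<U>(2)[OF U] by simp
    qed auto
    also have "\<dots> = exp (real (r * s) - 5 * real (r * s))"
      using exp_of_nat_mult[of "r * s" "1::real"]
      by (simp flip: exp_add exp_of_nat_mult)
    also have "\<dots> \<le> exp (- real s)"
    proof -
      have "s \<le> r * s" using r by simp
      then have "real s \<le> real (r * s)" by (rule of_nat_mono)
      then show ?thesis by simp
    qed
    finally show ?thesis .
  qed
  have b2: "(\<Sum>R\<in>?B2 U. rweight q V R) \<le> exp (- real s)" if U: "U \<in> \<U>" for U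
  proof -
    have fU: "finite U" using \<U>(2)[OF U] V finite_subset by blast
    have "(\<Sum>e\<in>?EU U. q ^ card e) \<le> (\<Sum>e\<in>(\<Union>v\<in>U. {e. e \<in> E \<and> v \<in> e}). q ^ card e)"
      by (rule sum_mono2) (use fE fU q in auto)
    also have "\<dots> \<le> (\<Sum>v\<in>U. \<Sum>e | e \<in> E \<and> v \<in> e. q ^ card e)"
      by (rule sum_UNION_le) (use fU fE q in auto)
    also have "\<dots> \<le> (\<Sum>v\<in>U. q / (200 * r))"
      using \<U>(2)[OF U] deg by (intro sum_mono) auto
    also have "\<dots> = (q * card U) / (200 * r)" by simp
    also have "\<dots> \<le> (20 * r * s) / (200 * r)"
      using \<U>(2)[OF U] r by (intro divide_right_mono) auto
    also have "\<dots> = s / 10" using r by simp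
    finally have \<mu>: "(\<Sum>e\<in>?EU U. q ^ card e) \<le> s / 10" .
    \<comment> \<open>The free parameter is set to \<open>exp 2\<close>. As
      \<open>exp 2 \<le> 10\<close>, the factor \<open>exp (exp 2 * s / 10)\<close> is at most
      \<open>exp s\<close>, so the gain \<open>exp (- 2 * s)\<close> leaves
      \<open>exp (- s)\<close>.\<close>
    have "(\<Sum>R\<in>?B2 U. rweight q V R) \<le> exp (exp 2 * (s / 10)) / exp 2 ^ s"
      using E q by (intro rweight_disjoint_family[OF V _ _ _ \<mu>]) auto
    also have "\<dots> = exp (exp 2 * (s / 10) - 2 * s)"
      by (simp add: exp_diff mult.commute flip: exp_of_nat_mult)
    also have "\<dots> \<le> exp (- real s)"
    proof -
      have "exp (2::real) = exp 1 * exp 1" by (simp flip: exp_add)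
      also have "\<dots> \<le> 3 * 3" using exp_le by (intro mult_mono) auto
      finally have "exp 2 \<le> (10::real)" by simp
      then have "exp 2 * (real s / 10) \<le> 10 * (real s / 10)" by (intro mult_right_mono) auto
      then show ?thesis by simp
    qed
    finally show ?thesis .
  qed
  define B where "B U = ?B1 U \<union> ?B2 U" for U
  have fB: "finite (B U)" for U unfolding B_def by (intro finite_UnI fP)
  have b: "(\<Sum>R\<in>B U. rweight q V R) \<le> exp (- real s) + exp (- real s)" if "U \<in> \<U>" for U
  proof -
    have "(\<Sum>R\<in>B U. rweight q V R) \<le> (\<Sum>R\<in>?B1 U. rweight q V R) + (\<Sum>R\<in>?B2 U. rweight q V R)"
      unfolding B_def by (subst sum.union_inter[symmetric]) (use fP w0 in \<open>auto intro!: sum_nonneg\<close>)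
    with b1[OF that] b2[OF that] show ?thesis by linarith
  qed
  have "\<exists>R\<subseteq>V. \<forall>U\<in>\<U>. R \<notin> B U"
  proof (rule ccontr)
    assume "\<not> ?thesis"
    then have sub: "Pow V \<subseteq> (\<Union>U\<in>\<U>. B U)" by blast
    have "1 = (\<Sum>R\<in>Pow V. rweight q V R)" by (simp add: sum_rweight[OF V])
    also have "\<dots> \<le> (\<Sum>R\<in>(\<Union>U\<in>\<U>. B U). rweight q V R)"
      by (rule sum_mono2) (use \<U>(1) fB sub w0 in auto)
    also have "\<dots> \<le> (\<Sum>U\<in>\<U>. \<Sum>R\<in>B U. rweight q V R)"
      by (rule sum_UNION_le) (use \<U>(1) fB w0 in auto)
    also have "\<dots> \<le> (\<Sum>U\<in>\<U>. exp (- real s) + exp (- real s))"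
      by (intro sum_mono b)
    also have "\<dots> < 1" using small by simp
    finally show False by simp
  qed
  then obtain R where R: "R \<subseteq> V" "\<And>U. U \<in> \<U> \<Longrightarrow> R \<notin> B U" by blast
  \<comment> \<open>delete all elements covered by a maximal family of disjoint edges inside \<open>R\<close>\<close>
  let ?M = "{F. F \<subseteq> E \<and> pairwise disjnt F \<and> \<Union>F \<subseteq> R}"
  have fM: "finite ?M" by (rule finite_subset[of ?M "Pow E"]) (use fE in auto)
  moreover have "{} \<in> ?M" by (simp add: pairwise_def disjnt_def)
  ultimately have "Max (card ` ?M) \<in> card ` ?M" by (intro Max_in) blast+
  then obtain F where F: "F \<in> ?M" "card F = Max (card ` ?M)" by auto
  have Fmax: "card F' \<le> card F" if "F' \<in> ?M" for F'
    using fM that unfolding F(2) by (intro Max_ge) auto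
  have fF: "finite F" using F fE finite_subset by blast
  define I where "I = R - \<Union>F"
  have "\<not> e \<subseteq> I" if e: "e \<in> E" for e
  proof
    assume eI: "e \<subseteq> I"
    \<comment> \<open>An edge inside \<open>I\<close> is nonempty and avoids every edge of
      \<open>F\<close>, so it is new and would enlarge the maximal family.\<close>
    have "insert e F \<in> ?M" using F(1) e eI unfolding I_def pairwise_def disjnt_def by auto
    moreover have "e \<notin> F" using E[OF e] eI unfolding I_def by blast
    ultimately show False using Fmax[of "insert e F"] fF by simp
  qed
  moreover have "I \<inter> U \<noteq> {}" if U: "U \<in> \<U>" for U
  proof
    assume emp: "I \<inter> U = {}"
    let ?F = "F \<inter> ?EU U"
    have FE: "F \<subseteq> E" "pairwise disjnt F" "\<Union>F \<subseteq> R" using F(1) by simp_all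
    have sub: "R \<inter> U \<subseteq> \<Union>?F"
    proof
      fix x assume x: "x \<in> R \<inter> U"
      then obtain e where "e \<in> F" "x \<in> e" using emp unfolding I_def by blast
      then show "x \<in> \<Union>?F" using x FE(1) by blast
    qed
    have cF: "card ?F < s"
    proof (rule ccontr)
      assume "\<not> card ?F < s"
      then have "s \<le> card ?F" by linarith
      then obtain F' where F': "F' \<subseteq> ?F" "card F' = s"
        by (rule obtain_subset_with_card_n)
      have "F' \<subseteq> F" "F' \<subseteq> ?EU U" using F'(1) by simp_all
      moreover have "pairwise disjnt F'" using FE(2) \<open>F' \<subseteq> F\<close> by (rule pairwise_subset)
      moreover have "\<Union>F' \<subseteq> R" using \<open>F' \<subseteq> F\<close> FE(3) by (meson Union_mono order_trans)
      ultimately have "R \<in> ?B2 U" using F'(2) R(1) by blast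
      then show False using R(2)[OF U] unfolding B_def by blast
    qed
    have "card (R \<inter> U) \<le> card (\<Union>?F)"
    proof (rule card_mono[OF _ sub])
      have "\<Union>?F \<subseteq> V" using FE(3) R(1) by blast
      then show "finite (\<Union>?F)" using V finite_subset by blast
    qed
    also have "\<dots> \<le> (\<Sum>e\<in>?F. card e)" by (rule card_Union_le_sum_card)
    also have "\<dots> \<le> (\<Sum>e\<in>?F. r)" using E FE(1) by (intro sum_mono) blast
    also have "\<dots> \<le> r * s" using cF by simp
    finally have "R \<in> ?B1 U" using R(1) by simp
    then show False using R(2)[OF U] unfolding B_def by blast
  qed
  moreover have "I \<subseteq> V" using R(1) I_def by blast
  ultimately show ?thesis by blast
qed

subsection \<open>Lattice boxes and generic linear forms\<close>

text \<open>The functions are extensional, so a box over a finite set is finite and its vectors are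
  equal as soon as their first \<open>D\<close> coordinates agree.\<close>

definition box :: "nat \<Rightarrow> int set \<Rightarrow> (nat \<Rightarrow> int) set" where
  "box D A = {..<D} \<rightarrow>\<^sub>E A"

definition dot :: "nat \<Rightarrow> (nat \<Rightarrow> int) \<Rightarrow> (nat \<Rightarrow> int) \<Rightarrow> int" where
  "dot D w g = (\<Sum>i<D. w i * g i)"

lemma finite_box: "finite A \<Longrightarrow> finite (box D A)"
  unfolding box_def by (rule finite_PiE) auto

lemma card_box: "card (box D A) = card A ^ D"
  unfolding box_def by (simp add: card_PiE)

lemma boxD: "w \<in> box D A \<Longrightarrow> i < D \<Longrightarrow> w i \<in> A"
  unfolding box_def by auto

lemma restrict_in_box: "(\<And>i. i < D \<Longrightarrow> f i \<in> A) \<Longrightarrow> restrict f {..<D} \<in> box D A"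
  unfolding box_def by auto

lemma box_eqI: "w \<in> box D A \<Longrightarrow> w' \<in> box D B \<Longrightarrow> (\<And>i. i < D \<Longrightarrow> w i = w' i) \<Longrightarrow> w = w'"
  unfolding box_def by (rule PiE_ext) auto

lemma dot_restrict: "dot D (restrict f {..<D}) g = (\<Sum>i<D. f i * g i)"
  unfolding dot_def by (intro sum.cong) auto

text \<open>By \<open>ext\<close>, restriction to the coordinates outside \<open>T\<close> is
  injective on \<open>G\<close>. Linear equations modulo \<open>N\<close> supply \<open>ext\<close>
  below, with one or three coordinates in \<open>T\<close>.\<close>

lemma card_le_box_off_coords:
  assumes "finite A" "T \<subseteq> {..<D}" "G \<subseteq> box D A"
    and ext: "\<And>g g' i. g \<in> G \<Longrightarrow> g' \<in> G \<Longrightarrow> (\<And>j. j < D \<Longrightarrow> j \<notin> T \<Longrightarrow> g j = g' j) \<Longrightarrow> i \<in> T \<Longrightarrow> g i = g' i"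
  shows "card G \<le> card A ^ (D - card T)"
proof -
  let ?S = "{..<D} - T"
  let ?h = "\<lambda>g. restrict g ?S"
  have "inj_on ?h G"
  proof (rule inj_onI)
    fix g g' assume gg: "g \<in> G" "g' \<in> G" and eq: "?h g = ?h g'"
    have off: "g j = g' j" if "j < D" "j \<notin> T" for j
      using fun_cong[OF eq, of j] that by simp
    have "g i = g' i" if "i < D" for i
      using off ext[OF gg off] that by blast
    then show "g = g'" using gg assms(3) by (intro box_eqI) auto
  qed
  moreover have "?h ` G \<subseteq> ?S \<rightarrow>\<^sub>E A"
    using assms(3) unfolding box_def by (auto simp: subset_iff PiE_iff)
  ultimately have "card G \<le> card (?S \<rightarrow>\<^sub>E A)"
    by (intro card_inj_on_le finite_PiE) (use assms in auto)
  also have "\<dots> = card A ^ card ?S" by (simp add: card_PiE)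
  also have "card ?S = D - card T"
    using assms(2) by (subst card_Diff_subset) (auto intro: finite_subset)
  finally show ?thesis .
qed

section \<open>Linear equations modulo \<open>N\<close> and coplanar lattice points\<close>

lemma dot_diff_eq:
  assumes T: "T \<subseteq> {..<D}" and off: "\<And>j. j < D \<Longrightarrow> j \<notin> T \<Longrightarrow> g j = g' j"
  shows "dot D w g - dot D w g' = (\<Sum>i\<in>T. w i * (g i - g' i))"
proof -
  have "dot D w g - dot D w g' = (\<Sum>i<D. w i * (g i - g' i))"
    by (simp add: dot_def sum_subtractf right_diff_distrib)
  also have "\<dots> = (\<Sum>i\<in>T. w i * (g i - g' i))"
    using T off by (intro sum.mono_neutral_right) auto
  finally show ?thesis .
qed

lemma residues_eq:
  fixes x y :: int
  assumes "x \<in> {0..<int N}" "y \<in> {0..<int N}" "int N dvd x - y"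
  shows "x = y"
  using assms by (metis atLeastLessThan_iff mod_eq_dvd_iff mod_pos_pos_trivial)

text \<open>The coefficient at \<open>a\<close> is invertible modulo the prime \<open>N\<close>, so
  the equation determines coordinate \<open>a\<close> from the others.\<close>

lemma card_dot_eq_0:
  assumes p: "prime N" and a: "a < D" "\<not> int N dvd w a"
  shows "card {g \<in> box D {0..<int N}. [dot D w g = 0] (mod int N)} \<le> N ^ (D - 1)"
proof -
  have "card {g \<in> box D {0..<int N}. [dot D w g = 0] (mod int N)} \<le> card {0..<int N} ^ (D - card {a})"
  proof (rule card_le_box_off_coords)
    fix g g' i
    assume g: "g \<in> {g \<in> box D {0..<int N}. [dot D w g = 0] (mod int N)}"
      "g' \<in> {g \<in> box D {0..<int N}. [dot D w g = 0] (mod int N)}"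
      and off: "\<And>j. j < D \<Longrightarrow> j \<notin> {a} \<Longrightarrow> g j = g' j" and i: "i \<in> {a}"
    have "[dot D w g = dot D w g'] (mod int N)"
      using g by (metis (mono_tags, lifting) cong_sym cong_trans mem_Collect_eq)
    then have "int N dvd dot D w g - dot D w g'" by (simp add: cong_iff_dvd_diff)
    also have "dot D w g - dot D w g' = w a * (g a - g' a)"
      using a by (subst dot_diff_eq[of "{a}"]) (use off in auto)
    finally have "int N dvd g a - g' a"
      using a p by (simp add: prime_dvd_mult_iff)
    then have "g a = g' a" using g a boxD by (intro residues_eq[of _ N]) blast+
    then show "g i = g' i" using i by simp
  qed (use a in auto)
  then show ?thesis by simp
qed

text \<open>The minor on the columns \<open>a\<close>, \<open>b\<close>, \<open>c\<close> of the
  matrix with rows \<open>u\<close>, \<open>v\<close>, \<open>w\<close>. All minors with columns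
  below \<open>D\<close> vanish exactly when the three vectors, cut to \<open>D\<close> coordinates,
  are linearly dependent over the rationals.\<close>

definition det3 :: "nat \<Rightarrow> nat \<Rightarrow> nat \<Rightarrow> (nat \<Rightarrow> int) \<Rightarrow> (nat \<Rightarrow> int) \<Rightarrow> (nat \<Rightarrow> int) \<Rightarrow> int" where
  "det3 a b c u v w =
     u a * (v b * w c - v c * w b) - u b * (v a * w c - v c * w a) + u c * (v a * w b - v b * w a)"

lemma det3_nonzero_distinct:
  assumes "det3 a b c u v w \<noteq> 0"
  shows "a \<noteq> b \<and> a \<noteq> c \<and> b \<noteq> c"
proof -
  have "det3 a a c u v w = 0" "det3 a b a u v w = 0" "det3 a b b u v w = 0" for a b c
    by (simp_all add: det3_def algebra_simps)
  then show ?thesis using assms by metis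
qed

text \<open>Once \<open>6 * m ^ 3 < N\<close>, this bound makes a nonzero minor of small integer
  vectors stay nonzero modulo \<open>N\<close>.\<close>

lemma det3_bound:
  assumes "\<And>i. i \<in> {a, b, c} \<Longrightarrow> \<bar>u i\<bar> \<le> m \<and> \<bar>v i\<bar> \<le> m \<and> \<bar>w i\<bar> \<le> (m::int)"
  shows "\<bar>det3 a b c u v w\<bar> \<le> 6 * m ^ 3"
proof -
  have t: "\<bar>x * (y * z - y' * z')\<bar> \<le> 2 * m ^ 3"
    if "\<bar>x\<bar> \<le> m" "\<bar>y\<bar> \<le> m" "\<bar>z\<bar> \<le> m" "\<bar>y'\<bar> \<le> m" "\<bar>z'\<bar> \<le> m" for x y z y' z' :: int
  proof -
    have "\<bar>y * z\<bar> \<le> m * m" "\<bar>y' * z'\<bar> \<le> m * m" using that unfolding abs_mult by (auto intro!: mult_mono)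
    then have "\<bar>y * z - y' * z'\<bar> \<le> 2 * (m * m)" by linarith
    then have "\<bar>x\<bar> * \<bar>y * z - y' * z'\<bar> \<le> m * (2 * (m * m))" using that by (intro mult_mono) auto
    then show ?thesis by (simp add: abs_mult power3_eq_cube)
  qed
  have "\<bar>u a * (v b * w c - v c * w b)\<bar> \<le> 2 * m ^ 3" "\<bar>u b * (v a * w c - v c * w a)\<bar> \<le> 2 * m ^ 3"
    "\<bar>u c * (v a * w b - v b * w a)\<bar> \<le> 2 * m ^ 3"
    using assms by (intro t; simp)+
  then show ?thesis unfolding det3_def by linarith
qed

text \<open>Two solutions that agree off \<open>a\<close>, \<open>b\<close>, \<open>c\<close> differ
  by a kernel vector of a 3 by 3 matrix that is invertible modulo \<open>N\<close>, so by Cramer's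
  rule they coincide.\<close>

lemma card_three_dots:
  assumes p: "prime N" and abc: "a < D" "b < D" "c < D" and det: "\<not> int N dvd det3 a b c u v w"
  shows "card {g \<in> box D {0..<int N}. [dot D u g = x] (mod int N) \<and> [dot D v g = y] (mod int N)
            \<and> [dot D w g = z] (mod int N)} \<le> N ^ (D - 3)" (is "card ?G \<le> _")
proof -
  have ne: "a \<noteq> b" "a \<noteq> c" "b \<noteq> c"
    using det3_nonzero_distinct[of a b c u v w] det by (metis dvd_0_right)+
  have "card ?G \<le> card {0..<int N} ^ (D - card {a, b, c})"
  proof (rule card_le_box_off_coords)
    fix g g' i
    assume g: "g \<in> ?G" "g' \<in> ?G"
      and off: "\<And>j. j < D \<Longrightarrow> j \<notin> {a, b, c} \<Longrightarrow> g j = g' j" and i: "i \<in> {a, b, c}"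
    let ?e = "\<lambda>j. g j - g' j"
    have *: "int N dvd t a * ?e a + t b * ?e b + t c * ?e c"
      if "[dot D t g = s] (mod int N)" "[dot D t g' = s] (mod int N)" for t s
    proof -
      have "int N dvd dot D t g - dot D t g'"
        using that by (metis cong_iff_dvd_diff cong_sym cong_trans)
      also have "dot D t g - dot D t g' = (\<Sum>i\<in>{a,b,c}. t i * (g i - g' i))"
        using abc by (intro dot_diff_eq) (use off in auto)
      finally show ?thesis using ne by (simp add: add.assoc)
    qed
    have 1: "int N dvd u a * ?e a + u b * ?e b + u c * ?e c"
      "int N dvd v a * ?e a + v b * ?e b + v c * ?e c"
      "int N dvd w a * ?e a + w b * ?e b + w c * ?e c"
      using g by (auto intro!: *)
    have "int N dvd det3 a b c u v w * ?e j" if "j \<in> {a,b,c}" for j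
    proof -
      have cramer: "int N dvd (u a * ?e a + u b * ?e b + u c * ?e c) * A
          + (v a * ?e a + v b * ?e b + v c * ?e c) * B + (w a * ?e a + w b * ?e b + w c * ?e c) * C" for A B C
        by (intro dvd_add dvd_mult2 1)
      \<comment> \<open>Adjugate identities: combining the three relations with the cofactors of one
        column isolates a single difference, multiplied by the minor.\<close>
      have "det3 a b c u v w * ?e a = (u a * ?e a + u b * ?e b + u c * ?e c) * (v b * w c - v c * w b)
          + (v a * ?e a + v b * ?e b + v c * ?e c) * (w b * u c - w c * u b)
          + (w a * ?e a + w b * ?e b + w c * ?e c) * (u b * v c - u c * v b)"
        by (simp add: det3_def algebra_simps)
      then have aa: "int N dvd det3 a b c u v w * ?e a" using cramer by presburger
      have "det3 a b c u v w * ?e b = (u a * ?e a + u b * ?e b + u c * ?e c) * (v c * w a - v a * w c)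
          + (v a * ?e a + v b * ?e b + v c * ?e c) * (w c * u a - w a * u c)
          + (w a * ?e a + w b * ?e b + w c * ?e c) * (u c * v a - u a * v c)"
        by (simp add: det3_def algebra_simps)
      then have bb: "int N dvd det3 a b c u v w * ?e b" using cramer by presburger
      have "det3 a b c u v w * ?e c = (u a * ?e a + u b * ?e b + u c * ?e c) * (v a * w b - v b * w a)
          + (v a * ?e a + v b * ?e b + v c * ?e c) * (w a * u b - w b * u a)
          + (w a * ?e a + w b * ?e b + w c * ?e c) * (u a * v b - u b * v a)"
        by (simp add: det3_def algebra_simps)
      then have cc: "int N dvd det3 a b c u v w * ?e c" using cramer by presburger
      show ?thesis using that aa bb cc by blast
    qed
    then have "int N dvd ?e i" using i p det by (metis prime_dvd_mult_iff prime_nat_int_transfer)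
    moreover have "i < D" using i abc by auto
    ultimately show "g i = g' i" using g boxD by (intro residues_eq[of _ N]) blast+
  qed (use abc in auto)
  moreover have "card {a, b, c} = 3" using ne by simp
  ultimately show ?thesis by simp
qed

text \<open>The vanishing minors put \<open>P\<close> in an affine space of dimension at most 2, so
  at most two suitable coordinates determine a point. The cases are dimension 0, 1 and 2.\<close>

lemma card_box_points_le_square:
  fixes P :: "(nat \<Rightarrow> int) set"
  assumes m: "m > 0" and P: "P \<subseteq> box D {0..<int m}"
    and det: "\<And>p0 p1 p2 p3 a b c. \<lbrakk>p0 \<in> P; p1 \<in> P; p2 \<in> P; p3 \<in> P; a < D; b < D; c < D\<rbrakk> \<Longrightarrow>
       det3 a b c (\<lambda>i. p1 i - p0 i) (\<lambda>i. p2 i - p0 i) (\<lambda>i. p3 i - p0 i) = 0"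
  shows "card P \<le> m ^ 2"
proof (cases "\<exists>p0\<in>P. \<exists>p1\<in>P. p0 \<noteq> p1")
  case False
  then have "card P \<le> card {undefined :: nat \<Rightarrow> int}"
    by (intro card_inj_on_le[of "\<lambda>_. undefined"]) (auto simp: inj_on_def)
  also have "\<dots> \<le> m ^ 2" using m by simp
  finally show ?thesis .
next
  case True
  then obtain p0 p1 where p01: "p0 \<in> P" "p1 \<in> P" "p0 \<noteq> p1" by blast
  then obtain a where a: "a < D" "p1 a - p0 a \<noteq> 0"
    using P box_eqI[of p0 D _ p1] by force
  have coord: "p i \<in> {0..<int m}" if "p \<in> P" "i < D" for p i using P that boxD by blast
  show ?thesis
  proof (cases "\<forall>p2\<in>P. \<forall>b<D. (p1 a - p0 a) * (p2 b - p0 b) = (p1 b - p0 b) * (p2 a - p0 a)")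
    case True
    \<comment> \<open>All points lie on the line through \<open>p0\<close> and \<open>p1\<close>,
      along which coordinate \<open>a\<close> is not constant.\<close>
    have "inj_on (\<lambda>p. p a) P"
    proof (rule inj_onI)
      fix p p' assume p: "p \<in> P" "p' \<in> P" "p a = p' a"
      have "p b = p' b" if "b < D" for b
      proof -
        have "(p1 a - p0 a) * (p b - p0 b) = (p1 a - p0 a) * (p' b - p0 b)"
          using True p that by simp
        then show ?thesis using a by simp
      qed
      then show "p = p'" using p P by (intro box_eqI) auto
    qed
    then have "card P \<le> card {0..<int m}"
      by (rule card_inj_on_le) (use coord a in auto)
    also have "\<dots> \<le> m ^ 2" by (simp add: power2_eq_square)
    finally show ?thesis .
  next
    case False
    then obtain p2 b where p2: "p2 \<in> P" "b < D"
      and minor: "(p1 a - p0 a) * (p2 b - p0 b) - (p1 b - p0 b) * (p2 a - p0 a) \<noteq> 0" by auto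
    have "inj_on (\<lambda>p. (p a, p b)) P"
    proof (rule inj_onI)
      fix p p' assume p: "p \<in> P" "p' \<in> P" "(p a, p b) = (p' a, p' b)"
      have "p c = p' c" if c: "c < D" for c
      proof -
        have "det3 a b c (\<lambda>i. p1 i - p0 i) (\<lambda>i. p2 i - p0 i) (\<lambda>i. p i - p0 i) = 0"
          "det3 a b c (\<lambda>i. p1 i - p0 i) (\<lambda>i. p2 i - p0 i) (\<lambda>i. p' i - p0 i) = 0"
          using p p01 p2 a c by (auto intro!: det)
        \<comment> \<open>As \<open>p\<close> and \<open>p'\<close> agree at \<open>a\<close> and
          \<open>b\<close>, subtracting the two minors leaves only the entry at \<open>c\<close>,
          whose cofactor is the nonzero 2 by 2 minor.\<close>
        moreover have "((p1 a - p0 a) * (p2 b - p0 b) - (p1 b - p0 b) * (p2 a - p0 a)) * (p c - p' c) =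
            det3 a b c (\<lambda>i. p1 i - p0 i) (\<lambda>i. p2 i - p0 i) (\<lambda>i. p i - p0 i) -
            det3 a b c (\<lambda>i. p1 i - p0 i) (\<lambda>i. p2 i - p0 i) (\<lambda>i. p' i - p0 i)"
          using p(3) by (simp add: det3_def algebra_simps)
        ultimately have "((p1 a - p0 a) * (p2 b - p0 b) - (p1 b - p0 b) * (p2 a - p0 a)) * (p c - p' c) = 0"
          by simp
        then show ?thesis using minor by simp
      qed
      then show "p = p'" using p P by (intro box_eqI) auto
    qed
    then have "card P \<le> card ({0..<int m} \<times> {0..<int m})"
      by (rule card_inj_on_le) (use coord a p2 in auto)
    also have "\<dots> = m ^ 2" by (simp add: card_cartesian_product power2_eq_square)
    finally show ?thesis .
  qed
qed

section \<open>The sphere and the generic vector\<close>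

lemma exists_large_sphere:
  assumes m: "m > 0" and D: "D > 0"
  shows "\<exists>v::int. m ^ D \<le> D * m ^ 2 * card {s \<in> box D {0..<int m}. (\<Sum>i<D. s i ^ 2) = v}"
proof -
  let ?f = "\<lambda>s::nat \<Rightarrow> int. \<Sum>i<D. s i ^ 2" and ?B = "box D {0..<int m}"
  let ?A = "{0..<int (D * m ^ 2)}"
  have f: "?f s \<in> ?A" if s: "s \<in> ?B" for s
  proof -
    have "?f s < (\<Sum>i<D. int m ^ 2)"
    proof (rule sum_strict_mono)
      fix i assume "i \<in> {..<D}"
      then have "0 \<le> s i" "s i < int m" using boxD[OF s, of i] by auto
      then show "s i ^ 2 < int m ^ 2" by (intro power_strict_mono) auto
    qed (use D in auto)
    then show ?thesis by (simp add: sum_nonneg)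
  qed
  show ?thesis
  proof (rule ccontr)
    assume "\<not> ?thesis"
    then have lt: "D * m ^ 2 * card {s \<in> ?B. ?f s = v} < m ^ D" for v by (simp add: not_le)
    \<comment> \<open>Pigeonhole: the squared norm takes at most \<open>D * m ^ 2\<close> values on
      the cube, so not all spheres can be smaller than the average.\<close>
    have "?B = (\<Union>v\<in>?A. {s \<in> ?B. ?f s = v})" using f by blast
    then have "card ?B = card (\<Union>v\<in>?A. {s \<in> ?B. ?f s = v})" by simp
    also have "\<dots> \<le> (\<Sum>v\<in>?A. card {s \<in> ?B. ?f s = v})" by (rule card_UN_le) simp
    finally have "D * m ^ 2 * m ^ D \<le> (\<Sum>v\<in>?A. D * m ^ 2 * card {s \<in> ?B. ?f s = v})"
      by (simp add: card_box flip: sum_distrib_left)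
    also have "\<dots> < (\<Sum>v\<in>?A. m ^ D)"
      using lt m D by (intro sum_strict_mono) auto
    finally show False by (simp add: nat_mult_distrib nat_power_eq)
  qed
qed

text \<open>Parallelogram law: if \<open>s1\<close> is the midpoint of \<open>s0\<close> and
  \<open>s2\<close>, then twice the squared distance of \<open>s0\<close> and \<open>s1\<close>
  equals \<open>|s0|^2 + |s2|^2 - 2 |s1|^2\<close>, which is 0 on a sphere.\<close>

lemma sphere_no_3AP:
  assumes "s0 \<in> box D A" "s1 \<in> box D A"
    and v: "(\<Sum>i<D. s0 i ^ 2) = v" "(\<Sum>i<D. s1 i ^ 2) = v" "(\<Sum>i<D. s2 i ^ 2) = (v::int)"
    and mid: "\<And>i. i < D \<Longrightarrow> s0 i - 2 * s1 i + s2 i = 0"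
  shows "s0 = s1"
proof -
  have "(\<Sum>i<D. 2 * (s1 i - s0 i) ^ 2) = (\<Sum>i<D. s0 i ^ 2 + s2 i ^ 2 - 2 * s1 i ^ 2)"
  proof (rule sum.cong)
    fix i assume "i \<in> {..<D}"
    then have s2: "s2 i = 2 * s1 i - s0 i" using mid[of i] by simp
    show "2 * (s1 i - s0 i) ^ 2 = s0 i ^ 2 + s2 i ^ 2 - 2 * s1 i ^ 2"
      unfolding s2 by (simp add: power2_eq_square algebra_simps)
  qed simp
  also have "\<dots> = 0" using v by (simp add: sum.distrib sum_subtractf flip: sum_distrib_left)
  finally have "\<forall>i\<in>{..<D}. 2 * (s1 i - s0 i) ^ 2 = 0"
    by (subst (asm) sum_nonneg_eq_0_iff) auto
  then show ?thesis using assms by (intro box_eqI) auto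
qed

text \<open>Union bound over the vectors \<open>g\<close> modulo \<open>N\<close>. The first
  property serves second differences of points of the cube; in the second, the \<open>l * d\<close>
  are differences of terms of a \<open>k\<close>-term progression. Each choice of data in the second
  excludes at most \<open>N ^ (D - 3)\<close> vectors, and there are about \<open>N * k ^ 3\<close>
  choices up to powers of \<open>m\<close>, so \<open>k ^ 3\<close> must stay below
  \<open>N ^ 2\<close>. Two vectors instead of three would require \<open>k ^ 2 < N\<close>, which
  fails when \<open>k\<close> is of order \<open>sqrt (N * ln N)\<close>.\<close>

lemma exists_generic_vector:
  assumes p: "prime N" and D: "D \<ge> 3" and m: "m > 0" "6 * m ^ 3 < N" and k: "k > 0"
    and num: "(4 * m + 1) ^ D * N + (2 * k) ^ 3 * (2 * m + 1) ^ (3 * D) < N ^ 2"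
  obtains g where
    "\<And>w. \<lbrakk>w \<in> box D {-2 * int m..2 * int m}; \<exists>i<D. w i \<noteq> 0\<rbrakk> \<Longrightarrow> \<not> [dot D w g = 0] (mod int N)"
    and "\<And>d l1 l2 l3 u1 u2 u3 a b c. \<lbrakk>d \<in> {1..<int N}; l1 \<in> {-int k<..<int k};
        l2 \<in> {-int k<..<int k}; l3 \<in> {-int k<..<int k}; u1 \<in> box D {-int m..int m};
        u2 \<in> box D {-int m..int m}; u3 \<in> box D {-int m..int m}; a < D; b < D; c < D;
        [dot D u1 g = l1 * d] (mod int N); [dot D u2 g = l2 * d] (mod int N);
        [dot D u3 g = l3 * d] (mod int N)\<rbrakk> \<Longrightarrow> det3 a b c u1 u2 u3 = 0"
proof -
  let ?G = "box D {0..<int N}"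
  define W where "W = {w \<in> box D {-2 * int m..2 * int m}. \<exists>i<D. w i \<noteq> 0}"
  define L where "L = {-int k<..<int k}"
  define Bx where "Bx = box D {-int m..int m}"
  define J where "J = {(d, l1, l2, l3, u1, u2, u3) \<in> {1..<int N} \<times> L \<times> L \<times> L \<times> Bx \<times> Bx \<times> Bx.
    \<exists>a<D. \<exists>b<D. \<exists>c<D. det3 a b c u1 u2 u3 \<noteq> 0}"
  define G1 where "G1 w = {g \<in> ?G. [dot D w g = 0] (mod int N)}" for w
  define G2 where "G2 = (\<lambda>(d, l1, l2, l3, u1, u2, u3). {g \<in> ?G. [dot D u1 g = l1 * d] (mod int N) \<and>
    [dot D u2 g = l2 * d] (mod int N) \<and> [dot D u3 g = l3 * d] (mod int N)})"
  have "m ^ 1 \<le> m ^ 3" using m by (intro power_increasing) auto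
  then have m2: "2 * m < N" using m by simp
  have fin: "finite L" "finite Bx" "finite W" by (auto simp: L_def Bx_def W_def finite_box)
  have finJ: "finite J"
    by (rule finite_subset[of _ "{1..<int N} \<times> L \<times> L \<times> L \<times> Bx \<times> Bx \<times> Bx"])
       (auto simp: J_def fin)
  have c1: "card (G1 w) \<le> N ^ (D - 1)" if "w \<in> W" for w
  proof -
    from that obtain i where i: "i < D" "w i \<noteq> 0" "w \<in> box D {-2 * int m..2 * int m}"
      by (auto simp: W_def)
    then have "w i \<in> {-2 * int m..2 * int m}" by (intro boxD)
    \<comment> \<open>Entries are at most \<open>2 * m < N\<close> in absolute value, so a nonzero
      one stays nonzero modulo \<open>N\<close>.\<close>
    then have "\<not> int N dvd w i" using i m2 zdvd_imp_le[of "int N" "\<bar>w i\<bar>"] by auto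
    then show ?thesis unfolding G1_def using p i by (intro card_dot_eq_0)
  qed
  have c2: "card (G2 j) \<le> N ^ (D - 3)" if "j \<in> J" for j
  proof -
    obtain d l1 l2 l3 u1 u2 u3 where j: "j = (d, l1, l2, l3, u1, u2, u3)" by (metis prod_cases7)
    from that obtain a b c where abc: "a < D" "b < D" "c < D" "det3 a b c u1 u2 u3 \<noteq> 0"
      and u: "u1 \<in> Bx" "u2 \<in> Bx" "u3 \<in> Bx" unfolding J_def j by blast
    have bnd: "\<bar>v i\<bar> \<le> int m" if "v \<in> Bx" "i \<in> {a, b, c}" for v i
    proof -
      have "i < D" using that abc by auto
      with that(1) have "v i \<in> {-int m..int m}" unfolding Bx_def by (intro boxD)
      then show ?thesis by auto
    qed
    have "\<bar>det3 a b c u1 u2 u3\<bar> \<le> 6 * int m ^ 3"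
      by (rule det3_bound) (use bnd u in blast)
    also have "\<dots> < int N" using m(2) by (metis of_nat_less_iff of_nat_mult of_nat_numeral of_nat_power)
    finally have "\<not> int N dvd det3 a b c u1 u2 u3"
      using abc(4) zdvd_imp_le[of "int N" "\<bar>det3 a b c u1 u2 u3\<bar>"] by auto
    then show ?thesis unfolding G2_def j prod.case using p abc by (intro card_three_dots) auto
  qed
  have "card W \<le> card (box D {-2 * int m..2 * int m})"
    unfolding W_def by (intro card_mono finite_box) auto
  also have "\<dots> = (4 * m + 1) ^ D" by (simp add: card_box nat_add_distrib nat_mult_distrib)
  finally have cW: "card W \<le> (4 * m + 1) ^ D" .
  have cL: "card L \<le> 2 * k" by (simp add: L_def)
  have cB: "card Bx = (2 * m + 1) ^ D" by (simp add: Bx_def card_box nat_add_distrib nat_mult_distrib)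
  have "card J \<le> card ({1..<int N} \<times> L \<times> L \<times> L \<times> Bx \<times> Bx \<times> Bx)"
    by (rule card_mono) (auto simp: J_def fin)
  also have "\<dots> = card {1..<int N} * (card L * (card L * card L) * (card Bx * (card Bx * card Bx)))"
    by (simp add: card_cartesian_product mult.assoc)
  also have "\<dots> \<le> N * (2 * k * (2 * k * (2 * k)) * (card Bx * (card Bx * card Bx)))"
    using cL by (intro mult_mono) auto
  also have "\<dots> = N * ((2 * k) ^ 3 * (2 * m + 1) ^ (3 * D))"
    by (simp add: cB power3_eq_cube power_mult mult.commute[of 3 D] mult_ac)
  finally have cJ: "card J \<le> N * ((2 * k) ^ 3 * (2 * m + 1) ^ (3 * D))" .
  have "card ((\<Union>w\<in>W. G1 w) \<union> (\<Union>j\<in>J. G2 j)) \<le> card (\<Union>w\<in>W. G1 w) + card (\<Union>j\<in>J. G2 j)"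
    by (rule card_Un_le)
  also have "\<dots> \<le> (\<Sum>w\<in>W. card (G1 w)) + (\<Sum>j\<in>J. card (G2 j))"
    by (intro add_mono card_UN_le fin finJ)
  also have "\<dots> \<le> (\<Sum>w\<in>W. N ^ (D - 1)) + (\<Sum>j\<in>J. N ^ (D - 3))"
    by (intro add_mono sum_mono c1 c2)
  also have "\<dots> = card W * N ^ (D - 1) + card J * N ^ (D - 3)" by simp
  also have "\<dots> \<le> (4 * m + 1) ^ D * N ^ (D - 1) + N * ((2 * k) ^ 3 * (2 * m + 1) ^ (3 * D)) * N ^ (D - 3)"
    using cW cJ by (intro add_mono mult_right_mono) auto
  also have "\<dots> = N ^ (D - 2) * ((4 * m + 1) ^ D * N + (2 * k) ^ 3 * (2 * m + 1) ^ (3 * D))"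
  proof -
    from D have e: "D - 1 = Suc (D - 2)" "D - 2 = Suc (D - 3)" by simp_all
    show ?thesis unfolding e(1) power_Suc by (simp add: e(2) distrib_left mult_ac)
  qed
  also have "\<dots> < N ^ (D - 2) * N ^ 2" using num prime_gt_0_nat[OF p] by (intro mult_strict_left_mono) auto
  also have "\<dots> = N ^ (D - 2 + 2)" by (simp only: power_add)
  also have "D - 2 + 2 = D" using D by simp
  also have "N ^ D = card ?G" by (simp add: card_box)
  finally have lt: "card ((\<Union>w\<in>W. G1 w) \<union> (\<Union>j\<in>J. G2 j)) < card ?G" .
  have "\<exists>g\<in>?G. g \<notin> (\<Union>w\<in>W. G1 w) \<union> (\<Union>j\<in>J. G2 j)"
  proof (rule ccontr)
    assume "\<not> ?thesis"
    then have "?G \<subseteq> (\<Union>w\<in>W. G1 w) \<union> (\<Union>j\<in>J. G2 j)" by blast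
    moreover have "finite ((\<Union>w\<in>W. G1 w) \<union> (\<Union>j\<in>J. G2 j))"
      using fin finJ by (auto simp: G1_def G2_def finite_box)
    ultimately show False using lt card_mono by (metis not_le)
  qed
  then obtain g where g: "g \<in> ?G" "\<And>w. w \<in> W \<Longrightarrow> g \<notin> G1 w" "\<And>j. j \<in> J \<Longrightarrow> g \<notin> G2 j" by blast
  show ?thesis
  proof (rule that[of g])
    fix w assume "w \<in> box D {-2 * int m..2 * int m}" "\<exists>i<D. w i \<noteq> 0"
    then show "\<not> [dot D w g = 0] (mod int N)" using g(1) g(2)[of w] by (simp add: W_def G1_def)
  next
    fix d l1 l2 l3 u1 u2 u3 a b c
    assume H: "d \<in> {1..<int N}" "l1 \<in> {-int k<..<int k}" "l2 \<in> {-int k<..<int k}" "l3 \<in> {-int k<..<int k}"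
      "u1 \<in> box D {-int m..int m}" "u2 \<in> box D {-int m..int m}" "u3 \<in> box D {-int m..int m}"
      "a < D" "b < D" "c < D" "[dot D u1 g = l1 * d] (mod int N)" "[dot D u2 g = l2 * d] (mod int N)"
      "[dot D u3 g = l3 * d] (mod int N)"
    show "det3 a b c u1 u2 u3 = 0"
    proof (rule ccontr)
      assume "det3 a b c u1 u2 u3 \<noteq> 0"
      then have "\<exists>a<D. \<exists>b<D. \<exists>c<D. det3 a b c u1 u2 u3 \<noteq> 0" using H by blast
      then have "(d, l1, l2, l3, u1, u2, u3) \<in> J" using H by (simp add: J_def L_def Bx_def)
      from g(3)[OF this] g(1) H show False by (simp add: G2_def)
    qed
  qed
qed

subsection \<open>Conflicts between translates\<close>

lemma inj_on_affine_mod: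
  fixes j t :: int
  assumes p: "prime N" and j: "\<not> int N dvd j"
  shows "inj_on (\<lambda>c. (j * c + t) mod int N) {0..<int N}"
proof (rule inj_onI)
  fix c c' assume c: "c \<in> {0..<int N}" "c' \<in> {0..<int N}"
    and "(j * c + t) mod int N = (j * c' + t) mod int N"
  then have "int N dvd (j * c + t) - (j * c' + t)" by (simp add: mod_eq_dvd_iff)
  also have "\<dots> = j * (c - c')" by (simp add: algebra_simps)
  finally have "int N dvd c - c'" using p j by (simp add: prime_dvd_mult_iff)
  then show "c = c'" using c by (intro residues_eq)
qed

text \<open>In the application \<open>X\<close> consists of the residues \<open>w \<bullet> g\<close> with \<open>w\<close> in a box around \<open>0\<close>.
  A tuple of centers of a progression in \<open>I\<close> is affine up to \<open>X\<close>; all relations are multiplied by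
  \<open>b - a\<close> to avoid division modulo \<open>N\<close>.  When two centers coincide, the relations degenerate to
  a pair conflict.\<close>

definition pair_conflicts :: "nat \<Rightarrow> nat \<Rightarrow> int set \<Rightarrow> int set set" where
  "pair_conflicts N r X = {{c, c'} | c c'. c \<in> {0..<int N} \<and> c' \<in> {0..<int N} \<and> c \<noteq> c' \<and>
     (\<exists>j\<in>{1..<r}. (int j * (c' - c)) mod int N \<in> X)}"

definition near_AP :: "nat \<Rightarrow> nat \<Rightarrow> int set \<Rightarrow> (nat \<Rightarrow> int) \<Rightarrow> bool" where
  "near_AP N r X c \<longleftrightarrow> (\<forall>a<r. \<forall>b<r. \<forall>i<r.
     ((int b - int a) * c i - (int b - int i) * c a - (int i - int a) * c b) mod int N \<in> X)"

definition tuple_conflicts :: "nat \<Rightarrow> nat \<Rightarrow> int set \<Rightarrow> int set set" where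
  "tuple_conflicts N r X =
     {c ` {..<r} | c. c \<in> {..<r} \<rightarrow>\<^sub>E {0..<int N} \<and> inj_on c {..<r} \<and> near_AP N r X c}"

lemma not_dvd_small:
  assumes "\<bar>z\<bar> < int N" "z \<noteq> 0"
  shows "\<not> int N dvd z"
  using assms zdvd_imp_le[of "int N" "\<bar>z\<bar>"] by auto

text \<open>The vertex \<open>v\<close> may be either end of the pair, which gives
  \<open>?S1\<close> and \<open>?S2\<close>. Multiplication by \<open>j\<close> is invertible
  because \<open>0 < j < r \<le> N\<close>, so each end leaves at most \<open>card X\<close>
  partners.\<close>

lemma card_pair_conflicts:
  assumes p: "prime N" and r: "r \<le> N" and X: "finite X"
  shows "card {e \<in> pair_conflicts N r X. v \<in> e} \<le> 2 * r * card X"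
proof -
  let ?S1 = "\<lambda>j. {c \<in> {0..<int N}. (int j * c + - int j * v) mod int N \<in> X}"
  let ?S2 = "\<lambda>j. {c \<in> {0..<int N}. (- int j * c + int j * v) mod int N \<in> X}"
  have fin: "finite {c \<in> {0..<int N}. Q c}" for Q
    by (rule finite_subset[of _ "{0..<int N}"]) auto
  have "{e \<in> pair_conflicts N r X. v \<in> e} \<subseteq> (\<lambda>c. {v, c}) ` (\<Union>j\<in>{1..<r}. ?S1 j \<union> ?S2 j)"
    unfolding pair_conflicts_def
    by (auto simp: algebra_simps image_iff insert_commute)
  then have "card {e \<in> pair_conflicts N r X. v \<in> e} \<le> card (\<Union>j\<in>{1..<r}. ?S1 j \<union> ?S2 j)"
    by (rule surj_card_le[rotated]) (intro finite_UN_I finite_atLeastLessThan finite_UnI fin)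
  also have "\<dots> \<le> (\<Sum>j\<in>{1..<r}. card (?S1 j \<union> ?S2 j))" by (rule card_UN_le) simp
  also have "\<dots> \<le> (\<Sum>j\<in>{1..<r}. 2 * card X)"
  proof (rule sum_mono)
    fix j assume j: "j \<in> {1..<r}"
    have 1: "card (?S1 j) \<le> card X"
      by (rule card_inj_on_le[OF inj_on_subset[OF inj_on_affine_mod[of N "int j" "- int j * v"]]])
         (use j r p X not_dvd_small[of "int j" N] in auto)
    have 2: "card (?S2 j) \<le> card X"
      by (rule card_inj_on_le[OF inj_on_subset[OF inj_on_affine_mod[of N "- int j" "int j * v"]]])
         (use j r p X not_dvd_small[of "- int j" N] in auto)
    show "card (?S1 j \<union> ?S2 j) \<le> 2 * card X"
      using card_Un_le[of "?S1 j" "?S2 j"] 1 2 by linarith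
  qed
  also have "\<dots> \<le> 2 * r * card X" by (simp add: mult.commute)
  finally show ?thesis .
qed

text \<open>The entry \<open>b\<close> is free, and for given \<open>a\<close>-th and \<open>b\<close>-th entries each further entry is
  determined by the corresponding element of \<open>X\<close>, because \<open>b - a\<close> is invertible modulo \<open>N\<close>.\<close>

lemma card_near_APs_through:
  assumes p: "prime N" and r: "2 \<le> r" "r \<le> N" and X: "finite X" and a: "a < r"
  shows "card {c \<in> {..<r} \<rightarrow>\<^sub>E {0..<int N}. near_AP N r X c \<and> c a = v} \<le> N * card X ^ (r - 2)"
    (is "card ?C \<le> _")
proof -
  define b where "b = (if a = 0 then 1 else 0 :: nat)"
  have b: "b < r" "b \<noteq> a" using r a by (auto simp: b_def)
  let ?R = "{..<r} - {a, b}"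
  let ?x = "\<lambda>c i. ((int b - int a) * c i - (int b - int i) * c a - (int i - int a) * c b) mod int N"
  let ?h = "\<lambda>c. (c b, restrict (?x c) ?R)"
  have "inj_on ?h ?C"
  proof (rule inj_onI)
    fix c c' assume c: "c \<in> ?C" "c' \<in> ?C" and eq: "?h c = ?h c'"
    have nd: "\<not> int N dvd int b - int a"
      using b r a by (intro not_dvd_small) auto
    have cE: "c \<in> {..<r} \<rightarrow>\<^sub>E {0..<int N}" "c' \<in> {..<r} \<rightarrow>\<^sub>E {0..<int N}" using c by blast+
    have ab: "c a = c' a" "c b = c' b" using c arg_cong[OF eq, of fst] by simp_all
    have "c i = c' i" if i: "i \<in> {..<r}" for i
    proof (cases "i \<in> ?R")
      case True
      let ?t = "- (int b - int i) * c a - (int i - int a) * c b"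
      have "restrict (?x c) ?R = restrict (?x c') ?R" 
        using arg_cong[OF eq, of snd] unfolding snd_conv .
      from fun_cong[OF this, of i] have "?x c i = ?x c' i" unfolding restrict_apply'[OF True] .
      then have "((int b - int a) * c i + ?t) mod int N = ((int b - int a) * c' i + ?t) mod int N"
        using ab by (simp add: algebra_simps)
      moreover have "c i \<in> {0..<int N}" "c' i \<in> {0..<int N}" using cE[THEN PiE_mem] i by blast+
      ultimately show ?thesis by (rule inj_onD[OF inj_on_affine_mod[OF p nd]])
    next
      case False
      then show ?thesis using i ab by auto
    qed
    then show "c = c'" using cE by (intro PiE_ext)
  qed
  moreover have "?h ` ?C \<subseteq> {0..<int N} \<times> (?R \<rightarrow>\<^sub>E X)"
  proof
    fix y assume "y \<in> ?h ` ?C"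
    then obtain c where c: "c \<in> ?C" "y = ?h c" by blast
    have "c \<in> {..<r} \<rightarrow>\<^sub>E {0..<int N}" using c(1) by blast
    then have "c b \<in> {0..<int N}" by (rule PiE_mem) (use b in simp)
    moreover have "restrict (?x c) ?R \<in> ?R \<rightarrow>\<^sub>E X"
      unfolding restrict_PiE_iff
    proof
      fix i assume "i \<in> ?R"
      moreover have "near_AP N r X c" using c(1) by simp
      ultimately show "?x c i \<in> X" using a b(1) unfolding near_AP_def by blast
    qed
    ultimately show "y \<in> {0..<int N} \<times> (?R \<rightarrow>\<^sub>E X)" using c(2) by blast
  qed
  moreover have "finite ({0..<int N} \<times> (?R \<rightarrow>\<^sub>E X))"
    using X by (intro finite_cartesian_product finite_PiE) auto
  ultimately have "card ?C \<le> card ({0..<int N} \<times> (?R \<rightarrow>\<^sub>E X))"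
    by (rule card_inj_on_le)
  also have "\<dots> = N * card X ^ card ?R" by (simp add: card_cartesian_product card_PiE)
  also have "card ?R = r - 2" using a b by (subst card_Diff_subset) auto
  finally show ?thesis .
qed

lemma card_tuple_conflicts:
  assumes p: "prime N" and r: "2 \<le> r" "r \<le> N" and X: "finite X"
  shows "card {e \<in> tuple_conflicts N r X. v \<in> e} \<le> r * (N * card X ^ (r - 2))"
proof -
  let ?C = "\<lambda>a. {c \<in> {..<r} \<rightarrow>\<^sub>E {0..<int N}. near_AP N r X c \<and> c a = v}"
  have fC: "finite (?C a)" for a
    by (rule finite_subset[of _ "{..<r} \<rightarrow>\<^sub>E {0..<int N}"]) (auto intro: finite_PiE)
  have "{e \<in> tuple_conflicts N r X. v \<in> e} \<subseteq> (\<lambda>c. c ` {..<r}) ` (\<Union>a\<in>{..<r}. ?C a)"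
    unfolding tuple_conflicts_def by blast
  then have "card {e \<in> tuple_conflicts N r X. v \<in> e} \<le> card (\<Union>a\<in>{..<r}. ?C a)"
    by (rule surj_card_le[rotated]) (use fC in auto)
  also have "\<dots> \<le> (\<Sum>a\<in>{..<r}. card (?C a))" by (rule card_UN_le) simp
  also have "\<dots> \<le> (\<Sum>a\<in>{..<r}. N * card X ^ (r - 2))"
    by (intro sum_mono card_near_APs_through p r X) auto
  finally show ?thesis by simp
qed

lemma card_pair_conflict: "e \<in> pair_conflicts N r X \<Longrightarrow> card e = 2"
  unfolding pair_conflicts_def by (elim CollectE exE conjE) simp

lemma card_tuple_conflict: "e \<in> tuple_conflicts N r X \<Longrightarrow> card e = r"
  unfolding tuple_conflicts_def by (elim CollectE exE conjE) (simp add: card_image)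

text \<open>Shaped for the degree hypothesis of
  \<open>hypergraph_transversal_independent_set\<close>: a pair has weight \<open>q ^ 2\<close>, a
  tuple \<open>q ^ r\<close>.\<close>

lemma conflict_degree:
  fixes q :: real
  assumes p: "prime N" and r: "2 \<le> r" "r \<le> N" and X: "finite X" "card X \<le> A" and q: "0 \<le> q"
  shows "(\<Sum>e | e \<in> pair_conflicts N r X \<union> tuple_conflicts N r X \<and> v \<in> e. q ^ card e)
           \<le> 2 * r * A * q ^ 2 + r * N * A ^ (r - 2) * q ^ r"
proof -
  let ?P = "{e \<in> pair_conflicts N r X. v \<in> e}" and ?T = "{e \<in> tuple_conflicts N r X. v \<in> e}"
  have fin: "finite ?P" "finite ?T"
    by (rule finite_subset[of _ "Pow {0..<int N}"]; auto simp: pair_conflicts_def tuple_conflicts_def)+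
  have "{e. e \<in> pair_conflicts N r X \<union> tuple_conflicts N r X \<and> v \<in> e} = ?P \<union> ?T" by blast
  then have "(\<Sum>e | e \<in> pair_conflicts N r X \<union> tuple_conflicts N r X \<and> v \<in> e. q ^ card e)
      = (\<Sum>e\<in>?P \<union> ?T. q ^ card e)" by simp
  also have "\<dots> \<le> (\<Sum>e\<in>?P. q ^ card e) + (\<Sum>e\<in>?T. q ^ card e)"
    by (subst sum.union_inter[OF fin, symmetric]) (use q in \<open>auto intro!: sum_nonneg\<close>)
  also have "(\<Sum>e\<in>?P. q ^ card e) = (\<Sum>e\<in>?P. q ^ 2)"
    by (rule sum.cong) (simp_all add: card_pair_conflict[of _ N r X])
  also have "(\<Sum>e\<in>?T. q ^ card e) = (\<Sum>e\<in>?T. q ^ r)"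
    by (rule sum.cong) (simp_all add: card_tuple_conflict[of _ N r X])
  also have "(\<Sum>e\<in>?P. q ^ 2) \<le> (2 * r * A) * q ^ 2"
  proof -
    have "card ?P \<le> 2 * r * A"
      using card_pair_conflicts[OF p r(2) X(1), of v] mult_le_mono2[OF X(2), of "2 * r"] by linarith
    then have "real (card ?P) \<le> real (2 * r * A)" by (rule of_nat_mono)
    from mult_right_mono[OF this, of "q ^ 2"] show ?thesis by simp
  qed
  also have "(\<Sum>e\<in>?T. q ^ r) \<le> (r * N * A ^ (r - 2)) * q ^ r"
  proof -
    have "card ?T \<le> r * (N * A ^ (r - 2))"
      using card_tuple_conflicts[OF p r X(1), of v]
        mult_le_mono2[OF mult_le_mono2[OF power_mono[OF X(2), of "r - 2"]], of r N] by linarith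
    then have "real (card ?T) \<le> real (r * (N * A ^ (r - 2)))" by (rule of_nat_mono)
    from mult_right_mono[OF this, of "q ^ r"] q show ?thesis by (simp add: mult.assoc)
  qed
  finally show ?thesis by simp
qed

section \<open>Progressions in normal form and the conflicts they force\<close>

lemma is_AP_normal_form:
  assumes "is_AP N l A" "N > 0"
  obtains x d where "x \<in> {0..<int N}" "d \<in> {1..<int N}"
    "A = (\<lambda>i. (x + int i * d) mod int N) ` {..<l}" "inj_on (\<lambda>i. (x + int i * d) mod int N) {..<l}"
    "l \<ge> 2"
proof -
  from assms(1) obtain a d where l: "l \<ge> 2" and V: "A \<subseteq> carrier (residue_ring (int N))" and c: "card A = l"
    and A: "A = a ` {1..l}" and d: "\<not> [d = 0] (mod int N)"
    and a: "\<And>i. i \<in> {1..l} \<Longrightarrow> [a i = a 1 + (int i - 1) * d] (mod int N)"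
    unfolding is_AP_def by blast
  have V': "A \<subseteq> {0..<int N}" using V by (auto simp: residue_ring_def)
  \<comment> \<open>Indices are shifted to start at 0 and the difference is reduced to a residue, so
    that a pair of residues encodes the progression.\<close>
  let ?f = "\<lambda>i. (a 1 + int i * (d mod int N)) mod int N"
  have f: "a (Suc i) = ?f i" if i: "i < l" for i
  proof -
    have "a (Suc i) \<in> {0..<int N}" using A V' i by force
    then have "a (Suc i) = a (Suc i) mod int N" by simp
    also have "\<dots> = (a 1 + int i * d) mod int N" using a[of "Suc i"] i by (simp add: unique_euclidean_semiring_class.cong_def)
    also have "\<dots> = ?f i" by (metis mod_add_right_eq mod_mult_right_eq)
    finally show ?thesis .
  qed
  have "{1..l} = Suc ` {..<l}" by (simp only: image_Suc_lessThan)
  then have "A = (\<lambda>i. a (Suc i)) ` {..<l}" unfolding A by (simp only: image_image)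
  also have "\<dots> = ?f ` {..<l}" by (rule image_cong[OF refl]) (rule f, simp)
  finally have Af: "A = ?f ` {..<l}" .
  have "inj_on ?f {..<l}" by (rule eq_card_imp_inj_on) (use c[unfolded Af] in simp_all)
  moreover have "a 1 \<in> {0..<int N}" using V' l unfolding A by (meson atLeastAtMost_iff image_eqI le_refl one_le_numeral order_trans subsetD)
  moreover have "d mod int N \<in> {1..<int N}"
  proof -
    have "d mod int N \<noteq> 0" using d by (simp add: unique_euclidean_semiring_class.cong_def)
    moreover have "0 \<le> d mod int N" "d mod int N < int N" using assms(2) by simp_all
    ultimately show ?thesis by simp
  qed
  ultimately show ?thesis using that Af l by blast
qed

lemma card_APs:
  assumes "N > 0"
  shows "finite {K. is_AP N k K}" "card {K. is_AP N k K} \<le> N ^ 2"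
proof -
  let ?V = "{0..<int N}"
  let ?h = "\<lambda>(x, d). (\<lambda>i. (x + int i * d) mod int N) ` {..<k}"
  have sub: "{K. is_AP N k K} \<subseteq> ?h ` (?V \<times> ?V)"
  proof
    fix K assume "K \<in> {K. is_AP N k K}"
    then have "is_AP N k K" by simp
    then obtain x d where "x \<in> ?V" "d \<in> {1..<int N}" "K = (\<lambda>i. (x + int i * d) mod int N) ` {..<k}"
      using assms by (elim is_AP_normal_form)
    then show "K \<in> ?h ` (?V \<times> ?V)" by (intro image_eqI[of _ _ "(x, d)"]) auto
  qed
  show "finite {K. is_AP N k K}" by (rule finite_subset[OF sub]) simp
  have "card {K. is_AP N k K} \<le> card (?h ` (?V \<times> ?V))" by (rule card_mono[OF _ sub]) simp
  also have "\<dots> \<le> card (?V \<times> ?V)" by (rule card_image_le) simp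
  also have "\<dots> = N ^ 2" by (simp add: power2_eq_square)
  finally show "card {K. is_AP N k K} \<le> N ^ 2" .
qed

text \<open>Exact terms satisfy \<open>(b - a) * y i = (b - i) * y a + (i - a) * y b\<close>. Hence
  the defect of the centers is, up to sign, the same combination of the shifts, whose coordinates
  are at most \<open>3 * r * m\<close> in absolute value.\<close>

lemma near_AP_from_AP:
  assumes x: "\<And>i. i < r \<Longrightarrow> [c i + dot D (f i) g = x + int i * d] (mod int N)"
    and f: "\<And>i. i < r \<Longrightarrow> f i \<in> box D {0..<int m}"
  shows "near_AP N r ((\<lambda>w. dot D w g mod int N) ` box D {-3 * int r * int m..3 * int r * int m}) c"
  unfolding near_AP_def
proof (intro allI impI)
  fix a b i assume abi: "a < r" "b < r" "i < r"
  let ?\<beta> = "int b - int i" and ?\<gamma> = "int i - int a" and ?\<alpha> = "int b - int a"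
  let ?w = "restrict (\<lambda>j. ?\<beta> * f a j + ?\<gamma> * f b j - ?\<alpha> * f i j) {..<D}"
  have w: "?w \<in> box D {-3 * int r * int m..3 * int r * int m}"
  proof (rule restrict_in_box)
    fix j assume j: "j < D"
    have bound: "\<bar>y * f e j\<bar> \<le> int r * int m" if "e < r" "\<bar>y\<bar> \<le> int r" for y e
    proof -
      have "f e j \<in> {0..<int m}" using f[OF that(1)] j by (rule boxD)
      then show ?thesis unfolding abs_mult using that(2) by (intro mult_mono) auto
    qed
    have "\<bar>?\<beta> * f a j\<bar> \<le> int r * int m" "\<bar>?\<gamma> * f b j\<bar> \<le> int r * int m" "\<bar>?\<alpha> * f i j\<bar> \<le> int r * int m"
      using abi by (auto intro!: bound)
    then show "?\<beta> * f a j + ?\<gamma> * f b j - ?\<alpha> * f i j \<in> {-3 * int r * int m..3 * int r * int m}"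
      unfolding atLeastAtMost_iff by linarith
  qed
  have dw: "dot D ?w g = ?\<beta> * dot D (f a) g + ?\<gamma> * dot D (f b) g - ?\<alpha> * dot D (f i) g"
    by (simp add: dot_restrict dot_def sum_distrib_left algebra_simps sum.distrib sum_subtractf)
  have "[?\<alpha> * (c i + dot D (f i) g) - ?\<beta> * (c a + dot D (f a) g) - ?\<gamma> * (c b + dot D (f b) g)
      = ?\<alpha> * (x + int i * d) - ?\<beta> * (x + int a * d) - ?\<gamma> * (x + int b * d)] (mod int N)"
    by (intro cong_diff cong_mult cong_refl x abi)
  also have "?\<alpha> * (x + int i * d) - ?\<beta> * (x + int a * d) - ?\<gamma> * (x + int b * d) = 0"
    by (simp add: algebra_simps)
  also have "?\<alpha> * (c i + dot D (f i) g) - ?\<beta> * (c a + dot D (f a) g) - ?\<gamma> * (c b + dot D (f b) g)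
      = (?\<alpha> * c i - ?\<beta> * c a - ?\<gamma> * c b) - dot D ?w g"
    unfolding dw by (simp add: algebra_simps)
  finally have eq: "(?\<alpha> * c i - ?\<beta> * c a - ?\<gamma> * c b) mod int N = dot D ?w g mod int N"
    by (simp add: mod_eq_dvd_iff cong_0_iff)
  show "(?\<alpha> * c i - ?\<beta> * c a - ?\<gamma> * c b) mod int N
      \<in> (\<lambda>w. dot D w g mod int N) ` box D {-3 * int r * int m..3 * int r * int m}"
    by (rule image_eqI) (rule eq, rule w)
qed

text \<open>Distinct centers form a tuple conflict. If \<open>c a = c b\<close>, the relation at an
  index \<open>l\<close> with another value collapses to \<open>(b - a) * (c l - c a)\<close>, which
  makes \<open>{c a, c l}\<close> a pair conflict.\<close>

lemma near_AP_contains_conflict: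
  assumes c: "near_AP N r X c" "\<And>i. i < r \<Longrightarrow> c i \<in> {0..<int N}"
    and ne: "i < r" "i' < r" "c i \<noteq> c i'"
  shows "\<exists>e\<in>pair_conflicts N r X \<union> tuple_conflicts N r X. e \<subseteq> c ` {..<r}"
proof (cases "inj_on c {..<r}")
  case True
  let ?c = "restrict c {..<r}"
  have "?c \<in> {..<r} \<rightarrow>\<^sub>E {0..<int N}" using c(2) by auto
  moreover have "inj_on ?c {..<r}" using True by (simp add: inj_on_def)
  moreover have "near_AP N r X ?c" using c(1) unfolding near_AP_def by simp
  ultimately have "?c ` {..<r} \<in> tuple_conflicts N r X" unfolding tuple_conflicts_def by blast
  then show ?thesis by (intro bexI[of _ "?c ` {..<r}"]) auto
next
  case False
  then obtain a b where ab: "a < b" "b < r" "c a = c b"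
    by (auto simp: inj_on_def) (metis linorder_neqE_nat)
  obtain l where l: "l < r" "c l \<noteq> c a" using ne by metis
  have "((int b - int a) * c l - (int b - int l) * c a - (int l - int a) * c b) mod int N \<in> X"
    using c(1) ab l unfolding near_AP_def by (meson less_trans)
  also have "(int b - int a) * c l - (int b - int l) * c a - (int l - int a) * c b = int (b - a) * (c l - c a)"
    using ab by (simp add: of_nat_diff algebra_simps)
  finally have "\<exists>j\<in>{1..<r}. (int j * (c l - c a)) mod int N \<in> X"
    using ab by (intro bexI[of _ "b - a"]) auto
  moreover have "c a \<in> {0..<int N}" "c l \<in> {0..<int N}" using c(2) ab l by auto
  ultimately have "{c a, c l} \<in> pair_conflicts N r X"
    using l(2) unfolding pair_conflicts_def by (metis (mono_tags, lifting) mem_Collect_eq)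
  moreover have "{c a, c l} \<subseteq> c ` {..<r}" using ab l by auto
  ultimately show ?thesis by blast
qed

text \<open>Subtracting a base point \<open>p0\<close> turns incidences with the progression into
  congruences between \<open>(p - p0) \<bullet> g\<close> and \<open>l * d\<close> with
  \<open>|l| < k\<close>. By the choice of \<open>g\<close> all minors of three such differences
  vanish, so the points are coplanar.\<close>

lemma card_translate_meets_AP:
  assumes m: "m > 0" and S: "S \<subseteq> box D {0..<int m}" and d: "d \<in> {1..<int N}"
    and gen: "\<And>d l1 l2 l3 u1 u2 u3 a b c. \<lbrakk>d \<in> {1..<int N}; l1 \<in> {-int k<..<int k};
        l2 \<in> {-int k<..<int k}; l3 \<in> {-int k<..<int k}; u1 \<in> box D {-int m..int m};
        u2 \<in> box D {-int m..int m}; u3 \<in> box D {-int m..int m}; a < D; b < D; c < D;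
        [dot D u1 g = l1 * d] (mod int N); [dot D u2 g = l2 * d] (mod int N);
        [dot D u3 g = l3 * d] (mod int N)\<rbrakk> \<Longrightarrow> det3 a b c u1 u2 u3 = 0"
  shows "card {p \<in> S. (z + dot D p g) mod int N \<in> (\<lambda>i. (x + int i * d) mod int N) ` {..<k}} \<le> m ^ 2"
    (is "card ?P \<le> _")
proof (rule card_box_points_le_square[OF m])
  show "?P \<subseteq> box D {0..<int m}" using S by blast
  fix p0 p1 p2 p3 a b c
  assume p: "p0 \<in> ?P" "p1 \<in> ?P" "p2 \<in> ?P" "p3 \<in> ?P" and abc: "a < D" "b < D" "c < D"
  obtain i0 where i0: "i0 < k" "(z + dot D p0 g) mod int N = (x + int i0 * d) mod int N"
    using p(1) by blast
  let ?u = "\<lambda>p. restrict (\<lambda>i. p i - p0 i) {..<D}"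
  have *: "\<exists>l\<in>{-int k<..<int k}. [dot D (?u p) g = l * d] (mod int N)" if p': "p \<in> ?P" for p
  proof -
    obtain i where i: "i < k" "(z + dot D p g) mod int N = (x + int i * d) mod int N"
      using p' by blast
    have "[(z + dot D p g) - (z + dot D p0 g) = (x + int i * d) - (x + int i0 * d)] (mod int N)"
      using i i0 by (intro cong_diff) (auto simp: unique_euclidean_semiring_class.cong_def)
    moreover have "(z + dot D p g) - (z + dot D p0 g) = dot D (?u p) g"
      by (simp add: dot_restrict) (simp add: dot_def sum_subtractf left_diff_distrib)
    moreover have "(x + int i * d) - (x + int i0 * d) = (int i - int i0) * d" by (simp add: algebra_simps)
    ultimately show ?thesis using i i0 by (intro bexI[of _ "int i - int i0"]) auto
  qed
  have u: "?u p \<in> box D {-int m..int m}" if "p \<in> ?P" for p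
  proof (rule restrict_in_box)
    fix i assume i: "i < D"
    have "p \<in> box D {0..<int m}" "p0 \<in> box D {0..<int m}" using that p(1) S by blast+
    then have "p i \<in> {0..<int m}" "p0 i \<in> {0..<int m}" using i by (blast dest: boxD)+
    then show "p i - p0 i \<in> {-int m..int m}" by auto
  qed
  obtain l1 l2 l3 where l: "l1 \<in> {-int k<..<int k}" "l2 \<in> {-int k<..<int k}" "l3 \<in> {-int k<..<int k}"
    "[dot D (?u p1) g = l1 * d] (mod int N)" "[dot D (?u p2) g = l2 * d] (mod int N)"
    "[dot D (?u p3) g = l3 * d] (mod int N)" using *[OF p(2)] *[OF p(3)] *[OF p(4)] by blast
  have "det3 a b c (?u p1) (?u p2) (?u p3) = 0"
    by (rule gen[OF d l(1-3) u[OF p(2)] u[OF p(3)] u[OF p(4)] abc l(4-6)])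
  then show "det3 a b c (\<lambda>i. p1 i - p0 i) (\<lambda>i. p2 i - p0 i) (\<lambda>i. p3 i - p0 i) = 0"
    using abc by (simp add: det3_def)
qed

text \<open>Each pair in \<open>K \<times> S\<close> determines one center \<open>z\<close>; of
  these \<open>card K * card S\<close> incidences a single center carries at most \<open>h\<close>.
  This bounds from below the number of translates meeting a progression.\<close>

lemma card_sumset_double_count:
  fixes K :: "int set" and S :: "'a set" and N :: nat
  assumes K: "K \<subseteq> {0..<int N}" and S: "finite S"
    and fib: "\<And>z. card {p \<in> S. (z + \<phi> p) mod int N \<in> K} \<le> h"
  shows "card K * card S \<le> h * card {z \<in> {0..<int N}. \<exists>p\<in>S. (z + \<phi> p) mod int N \<in> K}"
proof -
  let ?U = "{z \<in> {0..<int N}. \<exists>p\<in>S. (z + \<phi> p) mod int N \<in> K}"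
  let ?P = "\<lambda>z. {p \<in> S. (z + \<phi> p) mod int N \<in> K}"
  let ?h = "\<lambda>(x, p). ((x - \<phi> p) mod int N, p)"
  have fU: "finite ?U" by (rule finite_subset[of _ "{0..<int N}"]) auto
  have bk: "((x - \<phi> p) mod int N + \<phi> p) mod int N = x" if "x \<in> K" for x p
  proof -
    have "((x - \<phi> p) mod int N + \<phi> p) mod int N = x mod int N" by (simp add: mod_simps)
    also have "\<dots> = x" using that K by (intro mod_pos_pos_trivial) auto
    finally show ?thesis .
  qed
  have "inj_on ?h (K \<times> S)"
    by (rule inj_on_inverseI[where g = "\<lambda>(z, p). ((z + \<phi> p) mod int N, p)"]) (auto simp: bk)
  moreover have "?h ` (K \<times> S) \<subseteq> Sigma ?U ?P"
  proof
    fix y assume "y \<in> ?h ` (K \<times> S)"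
    then obtain x p where y: "y = ((x - \<phi> p) mod int N, p)" "x \<in> K" "p \<in> S" by auto
    then have "x \<in> {0..<int N}" using K by blast
    then have "(x - \<phi> p) mod int N \<in> {0..<int N}" by simp
    moreover have "((x - \<phi> p) mod int N + \<phi> p) mod int N \<in> K" using bk y(2) by simp
    ultimately show "y \<in> Sigma ?U ?P" using y(3) unfolding y(1) by blast
  qed
  moreover have "finite (Sigma ?U ?P)" using fU S by auto
  ultimately have "card (K \<times> S) \<le> card (Sigma ?U ?P)" by (rule card_inj_on_le)
  also have "\<dots> = (\<Sum>z\<in>?U. card (?P z))" using fU S by (intro card_SigmaI) auto
  also have "\<dots> \<le> (\<Sum>z\<in>?U. h)" by (intro sum_mono fib)
  finally show ?thesis by (simp add: card_cartesian_product mult.commute)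
qed

text \<open>The hypotheses collect what the parameters must satisfy: \<open>num\<close> yields the
  generic vector, \<open>deg\<close> controls the conflicts, \<open>s\<close> pays for the union
  bound over at most \<open>N ^ 2\<close> progressions, and \<open>size\<close> provides
  \<open>u\<close> centers whose translates meet a given progression.\<close>

theorem AP_free_transversal:
  fixes N r k m D s u :: nat and q :: real
  assumes p: "prime N" and r: "3 \<le> r" "r \<le> N" and D: "3 \<le> D" and m: "m > 0" "6 * m ^ 3 < N" and k: "k > 0"
    and num: "(4 * m + 1) ^ D * N + (2 * k) ^ 3 * (2 * m + 1) ^ (3 * D) < N ^ 2"
    and q: "0 < q" "q \<le> 1"
    and deg: "2 * real r * real ((6 * r * m + 1) ^ D) * q ^ 2
        + real r * real N * real ((6 * r * m + 1) ^ D) ^ (r - 2) * q ^ r \<le> q / (200 * r)"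
    and u: "10 * r * s \<le> q * u" "q * u \<le> 20 * r * s"
    and s: "2 * real N ^ 2 * exp (- real s) < 1"
    and size: "u * (D * m ^ 4) \<le> k * m ^ D"
  shows "\<exists>I\<subseteq>{0..<int N}. \<not> (\<exists>A\<subseteq>I. is_AP N r A) \<and> (\<forall>K. is_AP N k K \<longrightarrow> I \<inter> K \<noteq> {})"
proof -
  let ?V = "{0..<int N}"
  have N0: "N > 0" using r by simp
  obtain g where
    gen1: "\<And>w. \<lbrakk>w \<in> box D {-2 * int m..2 * int m}; \<exists>i<D. w i \<noteq> 0\<rbrakk> \<Longrightarrow> \<not> [dot D w g = 0] (mod int N)"
    and gen2: "\<And>d l1 l2 l3 u1 u2 u3 a b c. \<lbrakk>d \<in> {1..<int N}; l1 \<in> {-int k<..<int k};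
        l2 \<in> {-int k<..<int k}; l3 \<in> {-int k<..<int k}; u1 \<in> box D {-int m..int m};
        u2 \<in> box D {-int m..int m}; u3 \<in> box D {-int m..int m}; a < D; b < D; c < D;
        [dot D u1 g = l1 * d] (mod int N); [dot D u2 g = l2 * d] (mod int N);
        [dot D u3 g = l3 * d] (mod int N)\<rbrakk> \<Longrightarrow> det3 a b c u1 u2 u3 = 0"
    by (rule exists_generic_vector[OF p D m k num]) (rule that)
  obtain v :: int where v: "m ^ D \<le> D * m ^ 2 * card {s \<in> box D {0..<int m}. (\<Sum>i<D. s i ^ 2) = v}"
    using exists_large_sphere[of m D] m D by auto
  define S where "S = {s \<in> box D {0..<int m}. (\<Sum>i<D. s i ^ 2) = v}"
  have S: "S \<subseteq> box D {0..<int m}" "finite S"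
    unfolding S_def using finite_box[of "{0..<int m}" D] by auto
  define X where "X = (\<lambda>w. dot D w g mod int N) ` box D {-3 * int r * int m..3 * int r * int m}"
  have fX: "finite X" unfolding X_def by (intro finite_imageI finite_box) simp
  have "card X \<le> card (box D {-3 * int r * int m..3 * int r * int m})"
    unfolding X_def by (intro card_image_le finite_box) simp
  also have "\<dots> = (6 * r * m + 1) ^ D"
  proof -
    have "nat (3 * int r * int m - (- 3 * int r * int m) + 1) = 6 * r * m + 1"
      by (simp add: nat_eq_iff)
    then show ?thesis by (simp add: card_box)
  qed
  finally have cX: "card X \<le> (6 * r * m + 1) ^ D" .
  let ?E = "pair_conflicts N r X \<union> tuple_conflicts N r X"
  let ?U = "\<lambda>K. {z \<in> ?V. \<exists>p\<in>S. (z + dot D p g) mod int N \<in> K}"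
  \<comment> \<open>Exactly \<open>u\<close> centers are kept per progression, because
    \<open>hypergraph_transversal_independent_set\<close> bounds \<open>q * card U\<close> from
    above as well.\<close>
  have ex: "\<exists>T. T \<subseteq> ?U K \<and> card T = u" if K: "is_AP N k K" for K
  proof -
    obtain x d where xd: "x \<in> ?V" "d \<in> {1..<int N}" "K = (\<lambda>i. (x + int i * d) mod int N) ` {..<k}"
      "inj_on (\<lambda>i. (x + int i * d) mod int N) {..<k}"
      using K N0 by (elim is_AP_normal_form)
    have KV: "K \<subseteq> ?V" using xd(3) N0 by auto
    have cK: "card K = k" using xd(3,4) by (simp add: card_image)
    have "card K * card S \<le> m ^ 2 * card (?U K)"
      using KV S(2)
    proof (rule card_sumset_double_count)
      fix z
      show "card {p \<in> S. (z + dot D p g) mod int N \<in> K} \<le> m ^ 2"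
        unfolding xd(3) by (rule card_translate_meets_AP[OF m(1) S(1) xd(2) gen2])
    qed
    then have c: "k * card S \<le> m ^ 2 * card (?U K)" by (simp only: cK)
    \<comment> \<open>One factor \<open>m ^ 2\<close> is the density loss of the sphere, the other
      the bound for a single translate.\<close>
    have "u * (D * m ^ 4) \<le> k * m ^ D" by (rule size)
    also have "\<dots> \<le> k * (D * m ^ 2 * card S)" using v unfolding S_def by (rule mult_le_mono2)
    also have "\<dots> = D * m ^ 2 * (k * card S)" by (simp add: mult_ac)
    also have "\<dots> \<le> D * m ^ 2 * (m ^ 2 * card (?U K))" using c by (rule mult_le_mono2)
    also have "\<dots> = card (?U K) * (D * m ^ 4)" by (simp add: mult_ac power2_eq_square power4_eq_xxxx)
    finally have "u \<le> card (?U K)" using m D by simp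
    then show ?thesis by (rule obtain_subset_with_card_n) blast
  qed
  define T where "T K = (SOME T. T \<subseteq> ?U K \<and> card T = u)" for K
  have T: "T K \<subseteq> ?U K \<and> card (T K) = u" if "is_AP N k K" for K
    unfolding T_def by (rule someI_ex) (rule ex[OF that])
  let ?\<U> = "T ` {K. is_AP N k K}"
  have "\<exists>I\<subseteq>?V. (\<forall>e\<in>?E. \<not> e \<subseteq> I) \<and> (\<forall>U\<in>?\<U>. I \<inter> U \<noteq> {})"
  proof (rule hypergraph_transversal_independent_set[where q = q and r = r and s = s])
    fix e assume "e \<in> ?E"
    then show "e \<subseteq> ?V \<and> e \<noteq> {} \<and> card e \<le> r"
    proof
      assume e: "e \<in> pair_conflicts N r X"
      then show ?thesis using card_pair_conflict[OF e] r unfolding pair_conflicts_def by auto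
    next
      assume e: "e \<in> tuple_conflicts N r X"
      then have "e \<subseteq> ?V" unfolding tuple_conflicts_def by blast
      then show ?thesis using card_tuple_conflict[OF e] r by auto
    qed
  next
    fix z
    have "2 \<le> r" "0 \<le> q" using r q by simp_all
    from conflict_degree[OF p this(1) r(2) fX cX this(2), of z] deg
    show "(\<Sum>e | e \<in> ?E \<and> z \<in> e. q ^ card e) \<le> q / (200 * r)" by linarith
  next
    show "finite ?\<U>" using card_APs(1)[OF N0] by simp
    have "card ?\<U> \<le> N ^ 2" using card_image_le[OF card_APs(1)[OF N0]] card_APs(2)[OF N0] by (rule le_trans)
    then have "real (card ?\<U>) \<le> real N ^ 2" by (metis of_nat_mono of_nat_power)
    then have "2 * real (card ?\<U>) * exp (- real s) \<le> 2 * real N ^ 2 * exp (- real s)"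
      by (intro mult_right_mono) auto
    with s have "2 * real (card ?\<U>) * exp (- real s) < 1" by linarith
    then show "2 * card ?\<U> * exp (- real s) < 1" by simp
  next
    fix U assume "U \<in> ?\<U>"
    then obtain K where K: "is_AP N k K" "U = T K" by blast
    then have "card U = u" "U \<subseteq> ?U K" using T by blast+
    moreover from this(2) have "U \<subseteq> ?V" by blast
    ultimately show "U \<subseteq> ?V \<and> 10 * r * s \<le> q * card U \<and> q * card U \<le> 20 * r * s"
      using u by simp
  qed (use q r in auto)
  then obtain I0 where I0: "I0 \<subseteq> ?V" "\<forall>e\<in>?E. \<not> e \<subseteq> I0" "\<forall>U\<in>?\<U>. I0 \<inter> U \<noteq> {}"
    by (elim exE conjE) (rule that)
  have I0T: "I0 \<inter> T K \<noteq> {}" if "is_AP N k K" for K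
    using I0(3) that by simp
  define I where "I = {(z + dot D p g) mod int N | z p. z \<in> I0 \<and> p \<in> S}"
  have "I \<subseteq> ?V" unfolding I_def using N0 by auto
  moreover have "I \<inter> K \<noteq> {}" if K: "is_AP N k K" for K
  proof -
    have "I0 \<inter> T K \<noteq> {}" using I0T K .
    moreover have "T K \<subseteq> ?U K" using T[OF K] ..
    ultimately obtain z p where "z \<in> I0" "p \<in> S" "(z + dot D p g) mod int N \<in> K" by blast
    then show ?thesis unfolding I_def by blast
  qed
  moreover have "\<not> is_AP N r A" if AI: "A \<subseteq> I" for A
  proof
    assume "is_AP N r A"
    then obtain x d where A: "A = (\<lambda>i. (x + int i * d) mod int N) ` {..<r}"
      "inj_on (\<lambda>i. (x + int i * d) mod int N) {..<r}"
      using N0 by (elim is_AP_normal_form)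
    have "\<forall>i. \<exists>z p. i < r \<longrightarrow> z \<in> I0 \<and> p \<in> S \<and> (x + int i * d) mod int N = (z + dot D p g) mod int N"
      using A(1) AI unfolding I_def by blast
    then obtain c f where cf: "\<And>i. i < r \<Longrightarrow> c i \<in> I0 \<and> f i \<in> S \<and>
        (x + int i * d) mod int N = (c i + dot D (f i) g) mod int N" by metis
    have cong: "[c i + dot D (f i) g = x + int i * d] (mod int N)" if "i < r" for i
      using cf[OF that] by (simp add: unique_euclidean_semiring_class.cong_def)
    have near: "near_AP N r X c"
      unfolding X_def using cong by (rule near_AP_from_AP) (use cf S(1) in auto)
    have cV: "c i \<in> ?V" if "i < r" for i using cf[OF that] I0(1) by blast
    have cI: "c ` {..<r} \<subseteq> I0" using cf by blast
    \<comment> \<open>As \<open>I0\<close> contains no conflict, all centers coincide and the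
      progression lies in a single translate.\<close>
    have eq: "c i = c j" if "i < r" "j < r" for i j
    proof (rule ccontr)
      assume "c i \<noteq> c j"
      with near_AP_contains_conflict[OF near cV that]
      have "\<exists>e\<in>?E. e \<subseteq> c ` {..<r}" by blast
      then show False using I0(2) cI by (meson order_trans)
    qed
    have lt: "0 < r" "1 < r" "2 < r" using r by auto
    \<comment> \<open>The second difference of the first three sphere points: with equal centers its
      product with \<open>g\<close> is 0 modulo \<open>N\<close>, so genericity makes it vanish over
      the integers.\<close>
    let ?w = "restrict (\<lambda>i. f 0 i - 2 * f 1 i + f 2 i) {..<D}"
    have fS: "f 0 \<in> S" "f 1 \<in> S" "f 2 \<in> S" using cf lt by auto
    have "[(c 0 + dot D (f 0) g) - 2 * (c 1 + dot D (f 1) g) + (c 2 + dot D (f 2) g)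
        = (x + int 0 * d) - 2 * (x + int 1 * d) + (x + int 2 * d)] (mod int N)"
      by (intro cong_add cong_diff cong_mult cong_refl cong lt)
    also have "(c 0 + dot D (f 0) g) - 2 * (c 1 + dot D (f 1) g) + (c 2 + dot D (f 2) g) = dot D ?w g"
      using eq[OF lt(1) lt(2)] eq[OF lt(1) lt(3)]
      by (simp add: dot_restrict) (simp add: dot_def algebra_simps sum.distrib sum_subtractf sum_distrib_left)
    finally have "[dot D ?w g = 0] (mod int N)" by simp
    moreover have "?w \<in> box D {-2 * int m..2 * int m}"
    proof (rule restrict_in_box)
      fix i assume i: "i < D"
      have "f 0 i \<in> {0..<int m}" "f 1 i \<in> {0..<int m}" "f 2 i \<in> {0..<int m}"
        using fS S(1) i by (blast dest: boxD)+
      then show "f 0 i - 2 * f 1 i + f 2 i \<in> {-2 * int m..2 * int m}" by auto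
    qed
    ultimately have "\<not> (\<exists>i<D. ?w i \<noteq> 0)" using gen1 by blast
    then have mid: "f 0 i - 2 * f 1 i + f 2 i = 0" if "i < D" for i using that by auto
    have "f 0 = f 1"
      using fS unfolding S_def
      by (intro sphere_no_3AP[of "f 0" D "{0..<int m}" "f 1" v "f 2"] mid) blast+
    then have "(x + int 0 * d) mod int N = (x + int 1 * d) mod int N"
      using cf[OF lt(1)] cf[OF lt(2)] eq[OF lt(1,2)] by simp
    then show False using A(2) lt by (auto dest: inj_onD[of _ _ 0 1])
  qed
  ultimately show ?thesis by blast
qed

subsection \<open>Choice of parameters\<close>

text \<open>With \<open>a = 1 / (r - 1)\<close> the length is about
  \<open>C * N powr a * ln N powr (1 - a)\<close>, and the last factor is at least 1. The crude
  upper bound, from \<open>a \<le> 1 / 2\<close>, is enough for the genericity count.\<close>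

lemma AP_length_bounds:
  fixes r N :: nat and C :: real
  assumes r: "r \<ge> 3" and C: "C > 0" and N: "N \<ge> 3"
  shows "C * real N powr (1 / (real r - 1)) \<le> AP_length r C N"
    and "AP_length r C N \<le> C * sqrt N * ln N + 1"
proof -
  define a where "a = 1 / (real r - 1)"
  have a: "0 < a" "a \<le> 1 / 2" using r by (auto simp: a_def field_simps)
  have "exp 1 \<le> real N" using exp_le N by linarith
  then have L: "1 \<le> ln (real N)" using N by (subst ln_ge_iff) auto
  have LN: "ln (real N) \<le> real N" using N ln_bound[of "real N"] by simp
  let ?z = "C * (real N / ln (real N)) powr a * ln (real N)"
  have z0: "0 \<le> ?z" using C L by simp
  have len: "AP_length r C N = nat \<lceil>?z\<rceil>" by (simp add: AP_length_def a_def)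
  have "1 \<le> ln (real N) powr (1 - a)" using L a by (intro ge_one_powr_ge_zero) auto
  from mult_left_mono[OF this, of "C * real N powr a"] C
  have "C * real N powr a \<le> C * real N powr a * (ln (real N) powr (1 - a))" by simp
  also have "\<dots> = ?z" using L N by (simp add: powr_divide powr_diff)
  also have "?z \<le> AP_length r C N" unfolding len by (rule real_nat_ceiling_ge)
  finally show "C * real N powr (1 / (real r - 1)) \<le> AP_length r C N" by (simp only: a_def)
  have "(real N / ln (real N)) powr a \<le> (real N / ln (real N)) powr (1 / 2)"
    using a L LN N by (intro powr_mono) (auto simp: le_divide_eq)
  also have "\<dots> \<le> real N powr (1 / 2)"
    using L N by (intro powr_mono2) (auto simp: divide_le_eq)
  also have "\<dots> = sqrt N" using N by (simp add: powr_half_sqrt)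
  finally have "?z \<le> C * sqrt N * ln N" using C L by (intro mult_right_mono mult_left_mono) auto
  moreover have "real (nat \<lceil>?z\<rceil>) \<le> ?z + 1" using z0 of_int_ceiling_le_add_one[of ?z] by simp
  ultimately show "AP_length r C N \<le> C * sqrt N * ln N + 1" unfolding len by linarith
qed

theorem theorem5:
  fixes r :: nat
  assumes "r \<ge> 3"
  shows "\<exists>(C :: real) (N0 :: nat). C > 0 \<and> N0 > 0 \<and>
    (\<forall>N :: nat. prime N \<and> N \<ge> N0 \<longrightarrow>
      (\<exists>I :: int set. I \<subseteq> carrier (residue_ring (int N)) \<and>
        (\<not> (\<exists>A. A \<subseteq> I \<and> is_AP N r A)) \<and>
        (\<forall>K. is_AP N (AP_length r C N) K \<longrightarrow> card (I \<inter> K) \<ge> 1)))"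
proof -
  define a where "a = 1 / (real r - 1)"
  \<comment> \<open>A multiple of \<open>r - 1\<close> makes the \<open>(r - 1)\<close>-th root of
    \<open>(B ^ D) ^ (r - 2)\<close> the power \<open>B ^ (5 * (r - 2))\<close>. The surplus
    \<open>m ^ 5\<close> in \<open>m ^ D\<close> pays for \<open>m ^ 4\<close> in
    \<open>size\<close> and for the factor \<open>m\<close> in \<open>t\<close>.\<close>
  define D where "D = 5 * (r - 1)"
  \<comment> \<open>Chosen so that \<open>r * c * q = q / (400 * r)\<close>, half of the allowed
    degree, which bounds each of \<open>deg1\<close> and \<open>deg2\<close>.\<close>
  define c where "c = 1 / (400 * real r ^ 2)"
  \<comment> \<open>The constant left in \<open>size\<close> once \<open>y * m ^ D\<close> is split
    off: 31 comes from rounding \<open>30 * t\<close>, and 7 from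
    \<open>B \<le> 7 * r * m\<close>.\<close>
  define C where "C = 31 * real r * real D * (7 * real r) ^ (5 * (r - 2)) / c"
  have r0: "real r \<ge> 3" "r > 0" using assms by simp_all
  have a: "a > 0" using r0 by (simp add: a_def)
  have "1 \<le> 400 * real r ^ 2" using r0 one_le_power[of "real r" 2] by linarith
  then have c: "0 < c" "c \<le> 1" using r0 by (simp_all add: c_def)
  have C0: "C > 0" using r0 c assms by (simp add: C_def D_def)
  \<comment> \<open>The growth conditions give in turn \<open>2 * B ^ 5 \<le> y\<close> for
    \<open>deg1\<close>, then \<open>num\<close>, then \<open>6 * m ^ 3 < N\<close>;
    \<open>ln x + 1\<close> bounds the rounded \<open>m\<close>.\<close>
  have "eventually (\<lambda>x::real. 2 * (6 * real r * (ln x + 1) + 1) ^ 5 \<le> x powr a) at_top"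
    using a r0 by real_asymp
  moreover have "eventually (\<lambda>x::real. (4 * (ln x + 1) + 1) ^ D * x
      + (2 * (C * sqrt x * ln x + 1)) ^ 3 * (2 * (ln x + 1) + 1) ^ (3 * D) < x ^ 2) at_top"
    using C0 by real_asymp
  moreover have "eventually (\<lambda>x::real. 6 * (ln x + 1) ^ 3 < x) at_top" by real_asymp
  moreover have "eventually (\<lambda>x::real. real r \<le> x) at_top" by (rule eventually_ge_at_top)
  ultimately have "eventually (\<lambda>x::real. 2 * (6 * real r * (ln x + 1) + 1) ^ 5 \<le> x powr a \<and>
      (4 * (ln x + 1) + 1) ^ D * x + (2 * (C * sqrt x * ln x + 1)) ^ 3 * (2 * (ln x + 1) + 1) ^ (3 * D) < x ^ 2 \<and>
      6 * (ln x + 1) ^ 3 < x \<and> real r \<le> x) at_top"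
    by eventually_elim simp
  then have "eventually (\<lambda>N::nat. 2 * (6 * real r * (ln N + 1) + 1) ^ 5 \<le> N powr a \<and>
      (4 * (ln N + 1) + 1) ^ D * N + (2 * (C * sqrt N * ln N + 1)) ^ 3 * (2 * (ln N + 1) + 1) ^ (3 * D) < real N ^ 2 \<and>
      6 * (ln N + 1) ^ 3 < N \<and> real r \<le> N) at_top"
    by (rule eventually_compose_filterlim[OF _ filterlim_real_sequentially])
  then obtain N0 where N0: "\<And>N. N \<ge> N0 \<Longrightarrow> 2 * (6 * real r * (ln N + 1) + 1) ^ 5 \<le> N powr a \<and>
      (4 * (ln N + 1) + 1) ^ D * N + (2 * (C * sqrt N * ln N + 1)) ^ 3 * (2 * (ln N + 1) + 1) ^ (3 * D) < real N ^ 2 \<and>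
      6 * (ln N + 1) ^ 3 < N \<and> real r \<le> N"
    unfolding eventually_at_top_linorder by blast
  have "\<exists>I\<subseteq>{0..<int N}. \<not> (\<exists>A\<subseteq>I. is_AP N r A) \<and> (\<forall>K. is_AP N (AP_length r C N) K \<longrightarrow> I \<inter> K \<noteq> {})"
    if N: "prime N" "N \<ge> Suc N0" for N
  proof -
    from N0[of N] N(2) have h1: "2 * (6 * real r * (ln N + 1) + 1) ^ 5 \<le> N powr a"
      and h2: "(4 * (ln N + 1) + 1) ^ D * N + (2 * (C * sqrt N * ln N + 1)) ^ 3 * (2 * (ln N + 1) + 1) ^ (3 * D)
        < real N ^ 2"
      and h3: "6 * (ln N + 1) ^ 3 < N" and h4: "r \<le> N" by auto
    define m where "m = nat \<lceil>ln (real N)\<rceil>"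
    define k where "k = AP_length r C N"
    define y where "y = real N powr a"
    define B where "B = 6 * r * m + 1"
    \<comment> \<open>The solution of
      \<open>N * (B ^ D) ^ (r - 2) * q ^ (r - 1) = c ^ (r - 1)\<close>, which balances the tuple
      conflicts.\<close>
    define q where "q = c / (y * real B ^ (5 * (r - 2)))"
    define t where "t = real r * real m / q"
    \<comment> \<open>With \<open>s = 3 * m\<close> and \<open>q * t = r * m\<close>, the
      requirement \<open>10 * r * s \<le> q * u\<close> reads \<open>30 * t \<le> u\<close>.\<close>
    define u where "u = nat \<lceil>30 * t\<rceil>"
    have N3: "N \<ge> 3" using h4 assms by simp
    have "exp 1 \<le> real N" using exp_le N3 by linarith
    then have L: "1 \<le> ln (real N)" using N3 by (subst ln_ge_iff) auto
    have m_ge: "ln N \<le> m" unfolding m_def by (rule real_nat_ceiling_ge)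
    have m_le: "m \<le> ln N + 1" unfolding m_def using L of_int_ceiling_le_add_one[of "ln N"] by simp
    have m1: "m \<ge> 1" using m_ge L by linarith
    have k: "C * y \<le> k" "k \<le> C * sqrt N * ln N + 1"
      using AP_length_bounds[OF assms C0 N3] by (simp_all add: k_def y_def a_def)
    have y1: "1 \<le> y" unfolding y_def using N3 a by (intro ge_one_powr_ge_zero) auto
    have k0: "k > 0" using k(1) C0 y1 by (intro gr0I) (auto simp: mult_le_0_iff)
    have B1: "1 \<le> real B" by (simp add: B_def)
    have "1 \<le> y * real B ^ (5 * (r - 2))"
      using y1 B1 by (intro mult_ge1_I one_le_power) auto
    then have q: "0 < q" "q \<le> c" using c by (auto simp: q_def divide_le_eq)
    have q1: "q \<le> 1" using q c by linarith
    have yr: "y ^ (r - 1) = N"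
    proof -
      have "y ^ (r - 1) = y powr real (r - 1)" using y1 by (subst powr_realpow) auto
      also have "\<dots> = real N powr (a * real (r - 1))" by (simp add: y_def powr_powr)
      also have "a * real (r - 1) = 1" using assms by (simp add: a_def of_nat_diff)
      finally show ?thesis by simp
    qed
    have "6 * real m ^ 3 \<le> 6 * (ln N + 1) ^ 3"
      using m_le by (intro mult_left_mono power_mono) auto
    then have "real (6 * m ^ 3) < real N" using h3 by simp
    then have m3: "6 * m ^ 3 < N" by (rule of_nat_less_imp_less)
    have "real ((4 * m + 1) ^ D * N + (2 * k) ^ 3 * (2 * m + 1) ^ (3 * D))
        \<le> (4 * (ln N + 1) + 1) ^ D * N + (2 * (C * sqrt N * ln N + 1)) ^ 3 * (2 * (ln N + 1) + 1) ^ (3 * D)"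
      unfolding of_nat_add of_nat_mult of_nat_power
      using m_le k(2) L C0 by (intro add_mono mult_mono power_mono) auto
    also note h2
    finally have num: "(4 * m + 1) ^ D * N + (2 * k) ^ 3 * (2 * m + 1) ^ (3 * D) < N ^ 2"
      by (simp only: of_nat_less_iff flip: of_nat_power)
    have deg1: "2 * real r * real (B ^ D) * q ^ 2 \<le> q / (400 * r)"
    proof -
      have e: "D = 5 * (r - 2) + 5" using assms by (simp add: D_def)
      have "2 * real B ^ 5 \<le> 2 * (6 * real r * (ln N + 1) + 1) ^ 5"
        using m_le by (intro mult_left_mono power_mono) (auto simp: B_def intro!: mult_left_mono)
      also note h1
      finally have "2 * real B ^ 5 \<le> y" by (simp only: y_def)
      moreover have "real (B ^ D) * q = c * real B ^ 5 / y"
        using B1 by (simp add: q_def e power_add)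
      ultimately have "real (B ^ D) * q \<le> c / 2"
        using y1 c mult_left_mono[of "2 * real B ^ 5" y c] by (simp add: divide_le_eq)
      then have "2 * real r * (real (B ^ D) * q) * q \<le> 2 * real r * (c / 2) * q"
        using q by (intro mult_right_mono mult_left_mono) auto
      also have "\<dots> = q / (400 * r)" using r0 by (simp add: c_def power2_eq_square)
      finally show ?thesis by (simp add: power2_eq_square mult_ac)
    qed
    have deg2: "real r * real N * real (B ^ D) ^ (r - 2) * q ^ r \<le> q / (400 * r)"
    proof -
      have "q ^ (r - 1) = c ^ (r - 1) / (real N * real (B ^ D) ^ (r - 2))"
        by (simp add: q_def power_divide power_mult_distrib yr[simplified] D_def mult_ac flip: power_mult)
      then have "real N * real (B ^ D) ^ (r - 2) * q ^ (r - 1) = c ^ (r - 1)"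
        using N3 B1 by simp
      also have "\<dots> \<le> c ^ 1" using c assms by (intro power_decreasing) auto
      finally have "real N * real (B ^ D) ^ (r - 2) * q ^ (r - 1) \<le> c" by simp
      then have "real r * (real N * real (B ^ D) ^ (r - 2) * q ^ (r - 1)) * q \<le> real r * c * q"
        using q by (intro mult_right_mono mult_left_mono) auto
      also have "\<dots> = q / (400 * r)" using r0 by (simp add: c_def power2_eq_square)
      also have "real r * (real N * real (B ^ D) ^ (r - 2) * q ^ (r - 1)) * q
          = real r * real N * real (B ^ D) ^ (r - 2) * q ^ Suc (r - 1)"
        by (simp only: power_Suc mult_ac)
      also have "Suc (r - 1) = r" using assms by simp
      finally show ?thesis .
    qed
    have t1: "1 \<le> t"
    proof -
      have "1 * 1 \<le> real r * real m" using r0 m1 by (intro mult_mono) auto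
      then show ?thesis using q q1 by (simp add: t_def le_divide_eq)
    qed
    have qt: "q * t = real r * real m" using q by (simp add: t_def)
    have u_ge: "30 * t \<le> u" unfolding u_def by (rule real_nat_ceiling_ge)
    have u_le: "u \<le> 30 * t + 1"
      unfolding u_def using t1 of_int_ceiling_le_add_one[of "30 * t"] by simp
    \<comment> \<open>As \<open>m \<ge> ln N\<close>, the choice \<open>s = 3 * m\<close> gives a
      factor of at most \<open>1 / N ^ 3\<close> against \<open>2 * N ^ 2\<close>.\<close>
    have exp3: "2 * real N ^ 2 * exp (- real (3 * m)) < 1"
    proof -
      have "exp (- real (3 * m)) \<le> exp (- (3 * ln N))" using m_ge by simp
      also have "\<dots> = inverse (exp (ln N) ^ 3)" by (simp add: exp_minus flip: exp_of_nat_mult)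
      also have "exp (ln N) = N" using N3 by simp
      finally have "2 * real N ^ 2 * exp (- real (3 * m)) \<le> 2 * real N ^ 2 * inverse (real N ^ 3)"
        by (intro mult_left_mono) auto
      also have "\<dots> = 2 / N" using N3 by (simp add: field_simps power2_eq_square power3_eq_cube)
      also have "\<dots> < 1" using N3 by simp
      finally show ?thesis .
    qed
    have size: "u * (D * m ^ 4) \<le> k * m ^ D"
    proof -
      have e: "D = 5 * (r - 2) + 5" using assms by (simp add: D_def)
      have "real u \<le> 31 * t" using u_le t1 by linarith
      also have "t = real r * real m * y * real B ^ (5 * (r - 2)) / c"
        by (simp add: t_def q_def)
      also have "\<dots> \<le> real r * real m * y * (7 * real r * real m) ^ (5 * (r - 2)) / c"
      proof -
        have "1 * 1 \<le> real r * real m" using r0 m1 by (intro mult_mono) auto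
        then have "real B \<le> 7 * real r * real m" by (simp add: B_def mult.commute)
        then show ?thesis using y1 c by (intro divide_right_mono mult_left_mono power_mono) auto
      qed
      finally have "real u \<le> 31 * (real r * real m * y * (7 * real r * real m) ^ (5 * (r - 2)) / c)" by simp
      then have "real u * (real D * real m ^ 4)
          \<le> 31 * (real r * real m * y * (7 * real r * real m) ^ (5 * (r - 2)) / c) * (real D * real m ^ 4)"
        by (intro mult_right_mono) auto
      also have "\<dots> = C * y * real m ^ D"
        by (simp add: C_def e power_add power_mult_distrib power_Suc eval_nat_numeral mult_ac)
      also have "\<dots> \<le> real k * real m ^ D" using k(1) by (intro mult_right_mono) auto
      finally have "real (u * (D * m ^ 4)) \<le> real (k * m ^ D)" by simp
      then show ?thesis by (simp only: of_nat_le_iff)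
    qed
    show ?thesis
      unfolding k_def[symmetric]
    proof (rule AP_free_transversal[where m = m and D = D and q = q and u = u and s = "3 * m"])
      show "2 * real r * real ((6 * r * m + 1) ^ D) * q ^ 2
          + real r * real N * real ((6 * r * m + 1) ^ D) ^ (r - 2) * q ^ r \<le> q / (200 * r)"
        using deg1 deg2 unfolding B_def by simp
      have "30 * (q * t) \<le> q * u" using mult_left_mono[OF u_ge, of q] q(1) by (simp only: mult_ac)
      then show "10 * r * (3 * m) \<le> q * u" by (simp add: qt)
      have "q * u \<le> q * (30 * t + 1)" using u_le q by (intro mult_left_mono) auto
      also have "\<dots> = 30 * (q * t) + q" by (simp add: distrib_left)
      \<comment> \<open>Rounding costs \<open>q\<close>, which is at most \<open>q * t\<close>
        because \<open>t \<ge> 1\<close>.\<close>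
      also have "\<dots> \<le> 60 * (q * t)" using mult_left_mono[OF t1, of q] q(1) by linarith
      finally have "q * u \<le> 60 * (real r * real m)" by (simp only: qt)
      then show "q * u \<le> 20 * r * (3 * m)" by simp
    qed (use N(1) assms h4 m1 m3 k0 num q q1 exp3 size in \<open>auto simp: D_def\<close>)
  qed
  then have "\<forall>N. prime N \<and> N \<ge> Suc N0 \<longrightarrow>
      (\<exists>I :: int set. I \<subseteq> carrier (residue_ring (int N)) \<and> (\<not> (\<exists>A. A \<subseteq> I \<and> is_AP N r A)) \<and>
        (\<forall>K. is_AP N (AP_length r C N) K \<longrightarrow> card (I \<inter> K) \<ge> 1))"
  proof (intro allI impI)
    fix N assume main: "\<And>N. prime N \<Longrightarrow> Suc N0 \<le> N \<Longrightarrow> \<exists>I\<subseteq>{0..<int N}. \<not> (\<exists>A\<subseteq>I. is_AP N r A) \<and>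
        (\<forall>K. is_AP N (AP_length r C N) K \<longrightarrow> I \<inter> K \<noteq> {})"
      and N: "prime N \<and> Suc N0 \<le> N"
    from main[of N] N obtain I where I: "I \<subseteq> {0..<int N}" "\<not> (\<exists>A\<subseteq>I. is_AP N r A)"
      "\<And>K. is_AP N (AP_length r C N) K \<Longrightarrow> I \<inter> K \<noteq> {}" by blast
    have "finite I" using I(1) by (rule finite_subset) simp
    then have "card (I \<inter> K) \<ge> 1" if "is_AP N (AP_length r C N) K" for K
      using I(3)[OF that] by (simp add: Suc_le_eq card_gt_0_iff)
    moreover have "{0..<int N} = carrier (residue_ring (int N))" by (auto simp: residue_ring_def)
    ultimately show "\<exists>I :: int set. I \<subseteq> carrier (residue_ring (int N)) \<and> (\<not> (\<exists>A. A \<subseteq> I \<and> is_AP N r A)) \<and>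
        (\<forall>K. is_AP N (AP_length r C N) K \<longrightarrow> card (I \<inter> K) \<ge> 1)"
      using I(1,2) by (intro exI[of _ I]) simp
  qed
  \<comment> \<open>The successor makes the threshold positive.\<close>
  then show ?thesis using C0 by (intro exI[of _ C] exI[of _ "Suc N0"]) simp
qed

end
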